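(* Let $X$ be a compact oriented manifold with Riemannian metric $g$, let $B$ be a $2$-form on $X$, let $H$ be a closed $3$-form on $X$, and let $H'=H-dB$. Then $$(d^{H'})_g^\dagger=\varepsilon_B\circ(d^H)_{(g,B)}^\dagger\circ\varepsilon_B^{-1},\qquad \Delta^{H'}_g=\varepsilon_B\circ\Delta^H_{(g,B)}\circ\varepsilon_B^{-1}.$$
   Context: $X$ is smooth without boundary, $n=\dim X$; the forms $H$, $B$ are real. $d^H=d+H\wedge\cdot$ on $\Omega^\bullet(X)$ (or its complexification $\Omega^\bullet(X)^{\mathbb C}$), and $\varepsilon_B=e^B\wedge\cdot$. Born–Infeld metric of the generalized metric $(g,B)$: let $\sigma$ be the linear isomorphism of $\Omega^\bullet(X)$ reversing the order of wedge products of $1$-forms, so $\sigma(\omega\wedge\omega')=\sigma(\omega')\wedge\sigma(\omega)$. Choose a local oriented $g$-orthonormal frame $e_1,\dots,e_n$ and put $\hat e_i=\iota_{e_i}+\iota_{e_i}(g+B)\wedge\cdot$, where $\iota_{e_i}(g+B)$ is the $1$-form $g(e_i,\cdot)+B(e_i,\cdot)$. Define $\star_{(g,B)}\omega=\sigma(\hat e_n\cdots\hat e_2\hat e_1\omega)$ (independent of the oriented frame; equal to the Hodge star of $g$ when $B=0$), and $(\omega,\omega')_{(g,B)}=\int_X\omega\wedge\star_{(g,B)}\overline{\omega'}$ for $\omega,\omega'\in\Omega^\bullet(X)^{\mathbb C}$. Write $(\cdot,\cdot)_g=(\cdot,\cdot)_{(g,0)}$ for the usual $L^2$ scalar product. $(d^H)_{(g,B)}^\dagger$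 denotes the adjoint of $d^H$ with respect to $(\cdot,\cdot)_{(g,B)}$ and $\Delta^H_{(g,B)}=(d^H)_{(g,B)}^\dagger d^H+d^H(d^H)_{(g,B)}^\dagger$; $(d^{H'})_g^\dagger$ and $\Delta^{H'}_g$ denote the same objects for $H'$ and the usual scalar product $(\cdot,\cdot)_g$. *)

theory Defs
  imports "HOL-Analysis.Analysis" "HOL-Library.Function_Algebras"
begin

section \<open>Smooth functions on open sets\<close>

primrec Ck_on :: "nat \<Rightarrow> 'a::real_normed_vector set \<Rightarrow> ('a \<Rightarrow> 'b::real_normed_vector) \<Rightarrow> bool" where
  "Ck_on 0 S f \<longleftrightarrow> continuous_on S f"
| "Ck_on (Suc k) S f \<longleftrightarrow>
     (\<forall>x\<in>S. f differentiable (at x)) \<and> (\<forall>v. Ck_on k S (\<lambda>x. frechet_derivative f (at x) v))"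

definition smooth_on :: "'a::real_normed_vector set \<Rightarrow> ('a \<Rightarrow> 'b::real_normed_vector) \<Rightarrow> bool" where
  "smooth_on S f \<longleftrightarrow> (\<forall>k. Ck_on k S f)"


section \<open>The exterior algebra of a real vector space\<close>

text \<open>
  A complex-valued exterior form of mixed degree is a function on lists of vectors; its
  restriction to lists of length \<open>k\<close> is its component of degree \<open>k\<close>.
\<close>

type_synonym 'v ext = "'v list \<Rightarrow> complex"

definition alternating :: "'v::real_vector ext \<Rightarrow> bool" where
  "alternating a \<longleftrightarrow>
     (\<forall>us ws. linear (\<lambda>v. a (us @ v # ws))) \<and> (\<forall>vs. \<not> distinct vs \<longrightarrow> a vs = 0)"

text \<open>
  The sign of the shuffle that lists the positions in \<open>I\<close> (in increasing order) before the
  remaining positions below \<open>k\<close>.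
\<close>

definition shuffle_sign :: "nat \<Rightarrow> nat set \<Rightarrow> complex" where
  "shuffle_sign k I = (-1) ^ card {(i, j). i \<in> I \<and> j \<in> {..<k} - I \<and> j < i}"

text \<open>Normalised so that \<open>dx\<^sub>1 \<and> \<dots> \<and> dx\<^sub>n\<close> is the determinant.\<close>

definition wedge :: "'v ext \<Rightarrow> 'v ext \<Rightarrow> 'v ext" (infixr \<open>\<and>\<^sub>w\<close> 70) where
  "(a \<and>\<^sub>w b) vs =
     (\<Sum>I\<in>Pow {..<length vs}. shuffle_sign (length vs) I * a (nths vs I) * b (nths vs (- I)))"

definition ext_one :: "'v ext" where
  "ext_one vs = (if vs = [] then 1 else 0)"

text \<open>
  The exponential series in the exterior algebra. For a form without component of degree 0, only
  finitely many terms are nonzero on any given list.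
\<close>

definition ext_exp :: "'v ext \<Rightarrow> 'v ext" where
  "ext_exp b vs = (\<Sum>m. ((\<and>\<^sub>w) b ^^ m) ext_one vs / fact m)"

definition interior :: "'v \<Rightarrow> 'v ext \<Rightarrow> 'v ext" where
  "interior v a = (\<lambda>vs. a (v # vs))"

definition one_form :: "('v \<Rightarrow> complex) \<Rightarrow> 'v ext" where
  "one_form f vs = (case vs of [v] \<Rightarrow> f v | _ \<Rightarrow> 0)"

text \<open>
  On a product of 1-forms, evaluating on the reversed list of vectors is the same as reversing the
  factors (by invariance of the determinant under transposition); cf. \<open>reversal_wedge\<close> below.
\<close>

definition reversal :: "'v ext \<Rightarrow> 'v ext" where
  "reversal a = (\<lambda>vs. a (rev vs))"

lemma reversal_one_form: "reversal (one_form f) = one_form f"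
proof
  fix vs :: "'a list"
  show "reversal (one_form f) vs = one_form f vs"
    by (cases vs rule: rev_cases; cases vs)
       (auto simp: reversal_def one_form_def split: list.splits)
qed

lemma nths_rev:
  "nths (rev xs) I = rev (nths xs {i. i < length xs \<and> length xs - 1 - i \<in> I})"
proof (induction xs)
  case (Cons x xs)
  have "{i. i < length xs \<and> length xs - Suc i \<in> I} =
        {i. Suc i < Suc (length xs) \<and> length xs - Suc i \<in> I}" by auto
  then show ?case
    using Cons by (simp add: nths_append nths_Cons)
qed simp

lemma reversal_wedge: "reversal (a \<and>\<^sub>w b) = reversal b \<and>\<^sub>w reversal a"
proof
  fix vs :: "'a list"
  define k where "k = length vs"
  define r where "r I = {i. i < k \<and> k - 1 - i \<in> I}" for I
  have rr: "r (r I) = I" if "I \<subseteq> {..<k}" for I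
    using that by (force simp: r_def)
  have sgn: "shuffle_sign k ({..<k} - r I) = shuffle_sign k I" if I: "I \<subseteq> {..<k}" for I
  proof -
    define f where "f i = k - 1 - i" for i
    have f: "f i < k" "f (f i) = i" if "i < k" for i
      using that by (simp_all add: f_def)
    have less: "f i < f j \<longleftrightarrow> j < i" if "i < k" "j < k" for i j
      using that by (auto simp: f_def)
    have r: "i \<in> r J \<longleftrightarrow> i < k \<and> f i \<in> J" for i J
      by (simp add: r_def f_def)
    have "bij_betw (\<lambda>(i, j). (f j, f i))
            {(i, j). i \<in> I \<and> j \<in> {..<k} - I \<and> j < i}
            {(i, j). i \<in> {..<k} - r I \<and> j \<in> {..<k} - ({..<k} - r I) \<and> j < i}"
      by (rule bij_betw_byWitness[where f' = "\<lambda>(i, j). (f j, f i)"])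
         (use I in \<open>auto simp: f less r subset_iff\<close>)
    from bij_betw_same_card[OF this] show ?thesis
      by (simp only: shuffle_sign_def)
  qed
  have "reversal (a \<and>\<^sub>w b) vs =
      (\<Sum>I\<in>Pow {..<k}. shuffle_sign k I * a (nths (rev vs) I) * b (nths (rev vs) (- I)))"
    by (simp add: reversal_def wedge_def k_def)
  also have "\<dots> = (\<Sum>J\<in>Pow {..<k}. shuffle_sign k J * b (rev (nths vs J)) * a (rev (nths vs (- J))))"
  proof (rule sum.reindex_bij_witness[where i = "\<lambda>J. r ({..<k} - J)" and j = "\<lambda>I. {..<k} - r I"])
    fix I assume "I \<in> Pow {..<k}"
    then have I: "I \<subseteq> {..<k}" by simp
    have "{..<k} - ({..<k} - r I) = r I" by (auto simp: r_def)
    then show "r ({..<k} - ({..<k} - r I)) = I" using rr[OF I] by simp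
    have "r (- I) = {..<k} - r I" by (auto simp: r_def)
    moreover have "nths vs (- ({..<k} - r I)) = nths vs (r I)"
      unfolding nths_def k_def by (rule arg_cong[where f = "map fst"])
        (auto intro!: filter_cong dest: set_zip_rightD simp: r_def k_def)
    moreover have "nths (rev vs) K = rev (nths vs (r K))" for K
      by (simp add: nths_rev r_def k_def)
    ultimately show "shuffle_sign k ({..<k} - r I) * b (rev (nths vs ({..<k} - r I))) *
          a (rev (nths vs (- ({..<k} - r I)))) =
        shuffle_sign k I * a (nths (rev vs) I) * b (nths (rev vs) (- I))"
      by (simp only: sgn[OF I] ac_simps)
  next
    fix J assume "J \<in> Pow {..<k}"
    then have "{..<k} - J \<subseteq> {..<k}" "J \<subseteq> {..<k}" by auto
    then show "{..<k} - r (r ({..<k} - J)) = J" by (simp add: rr double_diff)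
  qed (auto simp: r_def)
  also have "\<dots> = (reversal b \<and>\<^sub>w reversal a) vs"
    by (simp add: reversal_def wedge_def k_def)
  finally show "reversal (a \<and>\<^sub>w b) vs = (reversal b \<and>\<^sub>w reversal a) vs" .
qed


section \<open>Oriented smooth manifolds\<close>

text \<open>
  A chart is its domain together with its coordinate map, of which only the values on the domain
  matter. The linear order on the index type makes coordinate frames ordered.
\<close>

type_synonym ('a, 'n) chart = "'a set \<times> ('a \<Rightarrow> real^'n)"

definition chart_image :: "('a, 'n::finite) chart \<Rightarrow> (real^'n) set" where
  "chart_image c = snd c ` fst c"

definition chart_inv :: "('a, 'n::finite) chart \<Rightarrow> real^'n \<Rightarrow> 'a" where
  "chart_inv c = inv_into (fst c) (snd c)"

definition is_chart :: "'a topology \<Rightarrow> ('a, 'n::finite) chart \<Rightarrow> bool" where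
  "is_chart X c \<longleftrightarrow> openin X (fst c) \<and> open (chart_image c) \<and>
     homeomorphic_map (subtopology X (fst c)) (top_of_set (chart_image c)) (snd c)"

text \<open>The part of the image of \<open>c\<close> on which the transition map to \<open>c'\<close> is defined.\<close>

definition overlap :: "('a, 'n::finite) chart \<Rightarrow> ('a, 'n) chart \<Rightarrow> (real^'n) set" where
  "overlap c c' = snd c ` (fst c \<inter> fst c')"

definition transition :: "('a, 'n::finite) chart \<Rightarrow> ('a, 'n) chart \<Rightarrow> real^'n \<Rightarrow> real^'n" where
  "transition c c' = snd c' \<circ> chart_inv c"

abbreviation D_transition ::
    "('a, 'n::finite) chart \<Rightarrow> ('a, 'n) chart \<Rightarrow> real^'n \<Rightarrow> real^'n \<Rightarrow> real^'n" where
  "D_transition c c' p \<equiv> frechet_derivative (transition c c') (at p)"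

text \<open>
  A smooth manifold without boundary, with the orientation in which all charts of the atlas \<open>A\<close>
  are positively oriented. The atlas need not be maximal.
\<close>

definition oriented_manifold :: "'a topology \<Rightarrow> ('a, 'n::finite) chart set \<Rightarrow> bool" where
  "oriented_manifold X A \<longleftrightarrow>
     Hausdorff_space X \<and> second_countable X \<and>
     (\<forall>c\<in>A. is_chart X c) \<and> (\<Union>c\<in>A. fst c) = topspace X \<and>
     (\<forall>c\<in>A. \<forall>c'\<in>A. smooth_on (overlap c c') (transition c c') \<and>
        (\<forall>p\<in>overlap c c'. det (matrix (D_transition c c' p)) > 0))"


section \<open>Tensor fields\<close>

text \<open>
  A differential form is given by its local representatives in the charts of the atlas, which are
  related by pullback along the transition maps. Representatives are extended by zero outside the
  atlas and outside the images of the charts, so that equality of forms is equality of functions.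
\<close>

type_synonym ('a, 'n) form = "('a, 'n) chart \<Rightarrow> real^'n \<Rightarrow> (real^'n) ext"

definition forms :: "('a, 'n::finite) chart set \<Rightarrow> ('a, 'n) form set" where
  "forms A = {\<omega>.
     (\<forall>c p. \<not> (c \<in> A \<and> p \<in> chart_image c) \<longrightarrow> \<omega> c p = 0) \<and>
     (\<forall>c\<in>A. \<forall>p\<in>chart_image c. alternating (\<omega> c p)) \<and>
     (\<forall>c\<in>A. \<forall>vs. smooth_on (chart_image c) (\<lambda>p. \<omega> c p vs)) \<and>
     (\<forall>c\<in>A. \<forall>c'\<in>A. \<forall>p\<in>overlap c c'. \<forall>vs.
        \<omega> c p vs = \<omega> c' (transition c c' p) (map (D_transition c c' p) vs))}"

definition real_forms :: "nat \<Rightarrow> ('a, 'n::finite) chart set \<Rightarrow> ('a, 'n) form set" where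
  "real_forms k A = {\<omega>\<in>forms A. \<forall>c p vs. \<omega> c p vs \<in> \<real> \<and> (length vs \<noteq> k \<longrightarrow> \<omega> c p vs = 0)}"

type_synonym ('a, 'n) metric = "('a, 'n) chart \<Rightarrow> real^'n \<Rightarrow> real^'n \<Rightarrow> real^'n \<Rightarrow> real"

definition riemannian_metric :: "('a, 'n::finite) chart set \<Rightarrow> ('a, 'n) metric \<Rightarrow> bool" where
  "riemannian_metric A g \<longleftrightarrow>
     (\<forall>c\<in>A. \<forall>p\<in>chart_image c. bilinear (g c p) \<and>
        (\<forall>v w. g c p v w = g c p w v) \<and> (\<forall>v. v \<noteq> 0 \<longrightarrow> g c p v v > 0)) \<and>
     (\<forall>c\<in>A. \<forall>v w. smooth_on (chart_image c) (\<lambda>p. g c p v w)) \<and>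
     (\<forall>c\<in>A. \<forall>c'\<in>A. \<forall>p\<in>overlap c c'. \<forall>v w.
        g c p v w = g c' (transition c c' p) (D_transition c c' p v) (D_transition c c' p w))"


section \<open>Operators on forms\<close>

definition form_wedge :: "('a, 'n) form \<Rightarrow> ('a, 'n) form \<Rightarrow> ('a, 'n) form" where
  "form_wedge \<alpha> \<beta> = (\<lambda>c p. \<alpha> c p \<and>\<^sub>w \<beta> c p)"

definition eps :: "('a, 'n) form \<Rightarrow> ('a, 'n) form \<Rightarrow> ('a, 'n) form" where
  "eps B \<omega> = (\<lambda>c p. ext_exp (B c p) \<and>\<^sub>w \<omega> c p)"

definition conj_form :: "('a, 'n) form \<Rightarrow> ('a, 'n) form" where
  "conj_form \<omega> = (\<lambda>c p vs. cnj (\<omega> c p vs))"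

text \<open>
  In a chart, \<open>(d\<omega>)\<^sub>p(v\<^sub>0, \<dots>, v\<^sub>k) = \<Sum>\<^sub>i (-1)\<^sup>i D\<^sub>p(\<omega>(v\<^sub>0, \<dots>, v\<^sub>i\<^sub>-\<^sub>1, v\<^sub>i\<^sub>+\<^sub>1, \<dots>, v\<^sub>k))(v\<^sub>i)\<close>.
\<close>

definition ext_deriv :: "('a, 'n::finite) chart set \<Rightarrow> ('a, 'n) form \<Rightarrow> ('a, 'n) form" where
  "ext_deriv A \<omega> = (\<lambda>c p vs.
     if c \<in> A \<and> p \<in> chart_image c
     then \<Sum>i<length vs. (-1) ^ i *
            frechet_derivative (\<lambda>q. \<omega> c q (take i vs @ drop (Suc i) vs)) (at p) (vs ! i)
     else 0)"

definition twisted_deriv ::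
    "('a, 'n::finite) chart set \<Rightarrow> ('a, 'n) form \<Rightarrow> ('a, 'n) form \<Rightarrow> ('a, 'n) form" where
  "twisted_deriv A H \<omega> = ext_deriv A \<omega> + form_wedge H \<omega>"


section \<open>Integration\<close>

definition smooth_function :: "('a, 'n::finite) chart set \<Rightarrow> ('a \<Rightarrow> real) \<Rightarrow> bool" where
  "smooth_function A f \<longleftrightarrow> (\<forall>c\<in>A. smooth_on (chart_image c) (f \<circ> chart_inv c))"

definition partition_of_unity ::
    "'a topology \<Rightarrow> ('a, 'n::finite) chart set \<Rightarrow> ('a, 'n) chart set \<Rightarrow>
     (('a, 'n) chart \<Rightarrow> 'a \<Rightarrow> real) \<Rightarrow> bool" where
  "partition_of_unity X A C \<rho> \<longleftrightarrow>
     finite C \<and> C \<subseteq> A \<and>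
     (\<forall>c\<in>C. smooth_function A (\<rho> c) \<and> (\<forall>x\<in>topspace X. 0 \<le> \<rho> c x) \<and>
        X closure_of {x\<in>topspace X. \<rho> c x \<noteq> 0} \<subseteq> fst c) \<and>
     (\<forall>x\<in>topspace X. (\<Sum>c\<in>C. \<rho> c x) = 1)"

definition std_frame :: "(real^'n::{finite,linorder}) list" where
  "std_frame = map (\<lambda>i. axis i 1) (sorted_list_of_set UNIV)"

text \<open>
  The integral of the component of top degree over a compact oriented manifold. It does not depend
  on the chosen partition of unity.
\<close>

definition form_integral ::
    "'a topology \<Rightarrow> ('a, 'n::{finite,linorder}) chart set \<Rightarrow> ('a, 'n) form \<Rightarrow> complex" where
  "form_integral X A \<omega> =
     (let (C, \<rho>) = (SOME (C, \<rho>). partition_of_unity X A C \<rho>)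
      in \<Sum>c\<in>C. LINT p:chart_image c|lborel. \<rho> c (chart_inv c p) *\<^sub>R \<omega> c p std_frame)"


section \<open>The Born--Infeld metric\<close>

definition oriented_orthonormal ::
    "(real^'n \<Rightarrow> real^'n \<Rightarrow> real) \<Rightarrow> ('n::finite \<Rightarrow> real^'n) \<Rightarrow> bool" where
  "oriented_orthonormal h e \<longleftrightarrow>
     (\<forall>i j. h (e i) (e j) = (if i = j then 1 else 0)) \<and> det (\<chi> i j. e j $ i) > 0"

definition e_hat ::
    "('v \<Rightarrow> 'v \<Rightarrow> real) \<Rightarrow> 'v ext \<Rightarrow> 'v \<Rightarrow> 'v ext \<Rightarrow> 'v ext" where
  "e_hat h b v a = interior v a + one_form (\<lambda>w. of_real (h v w) + b [v, w]) \<and>\<^sub>w a"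

text \<open>
  The star operator is pointwise: only the value of an oriented orthonormal frame at the point
  enters, and the result does not depend on it. The fold applies \<open>e_hat\<close> for the first frame vector
  first.
\<close>

definition BI_star ::
    "('a, 'n::{finite,linorder}) metric \<Rightarrow> ('a, 'n) form \<Rightarrow> ('a, 'n) form \<Rightarrow> ('a, 'n) form" where
  "BI_star g B \<omega> = (\<lambda>c p.
     let e = (SOME e. oriented_orthonormal (g c p) e)
     in reversal (fold (\<lambda>i. e_hat (g c p) (B c p) (e i)) (sorted_list_of_set UNIV) (\<omega> c p)))"

definition BI_inner ::
    "'a topology \<Rightarrow> ('a, 'n::{finite,linorder}) chart set \<Rightarrow> ('a, 'n) metric \<Rightarrow> ('a, 'n) form \<Rightarrow>
     ('a, 'n) form \<Rightarrow> ('a, 'n) form \<Rightarrow> complex" where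
  "BI_inner X A g B \<omega> \<omega>' = form_integral X A (form_wedge \<omega> (BI_star g B (conj_form \<omega>')))"

definition L2_inner ::
    "'a topology \<Rightarrow> ('a, 'n::{finite,linorder}) chart set \<Rightarrow> ('a, 'n) metric \<Rightarrow>
     ('a, 'n) form \<Rightarrow> ('a, 'n) form \<Rightarrow> complex" where
  "L2_inner X A g = BI_inner X A g 0"

text \<open>
  The adjoint of an operator \<open>P\<close> on the space \<open>V\<close> with respect to a sesquilinear pairing. As usual for
  total functions, it is 0 where the defining property does not determine a value; for the operators
  below, on forms on a compact manifold without boundary, this does not happen.
\<close>

definition adjoint_on ::
    "'f::zero set \<Rightarrow> ('f \<Rightarrow> 'f \<Rightarrow> complex) \<Rightarrow> ('f \<Rightarrow> 'f) \<Rightarrow> 'f \<Rightarrow> 'f" where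
  "adjoint_on V ip P y =
     (if \<exists>!z. z \<in> V \<and> (\<forall>x\<in>V. ip (P x) y = ip x z)
      then THE z. z \<in> V \<and> (\<forall>x\<in>V. ip (P x) y = ip x z)
      else 0)"

definition laplacian_on ::
    "'f::{zero,plus} set \<Rightarrow> ('f \<Rightarrow> 'f \<Rightarrow> complex) \<Rightarrow> ('f \<Rightarrow> 'f) \<Rightarrow> 'f \<Rightarrow> 'f" where
  "laplacian_on V ip P x = adjoint_on V ip P (P x) + P (adjoint_on V ip P x)"

end

theory Submission
  imports Defs
begin

text \<open>
  The isomorphism \<open>e\<^sup>B \<and> \<cdot>\<close> carries all the structure attached to \<open>(g, B)\<close> and \<open>H\<close> to the structure
  attached to \<open>(g, 0)\<close> and \<open>H - dB\<close>; adjoints and Laplacians, being defined from this structure, are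
  carried along. Three facts make this precise.

  It is a bijection of the space of smooth forms, with inverse \<open>e\<^sup>-\<^sup>B \<and> \<cdot>\<close> (\<open>bij_betw_eps\<close>).

  It is an isometry from the Born--Infeld pairing to the \<open>L\<^sup>2\<close> pairing (\<open>BI_inner_eq_L2_inner\<close>), because
  the integrands agree as forms. Contraction is an antiderivation and \<open>e\<^sup>B\<close> is even, so \<open>\<iota>\<^sub>v\<close> passes \<open>e\<^sup>B\<close> at the cost of
  \<open>\<iota>\<^sub>vB\<close>, which is exactly the \<open>B\<close>-part of \<open>e_hat\<close>: conjugation by \<open>e\<^sup>B\<close> turns the operator \<open>e_hat\<close> of
  \<open>(g, B)\<close> into that of \<open>(g, 0)\<close>. The factor \<open>e\<^sup>-\<^sup>B\<close> left in front of the product of these operators is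
  turned by the reversal into \<open>e\<^sup>B\<close>, since a 2-form is reversed to its negative, and, being even,
  it can be moved onto the first argument of the pairing.

  It intertwines the twisted differentials (\<open>twisted_deriv_eps\<close>): by the Leibniz rule \<open>d\<close> passes \<open>e\<^sup>B\<close>
  at the cost of \<open>dB\<close>, which is what \<open>H - dB\<close> compensates.

  The pointwise algebra rests on one recursion, \<open>wedge_Cons\<close>: contraction is an antiderivation of
  the wedge product. It holds for arbitrary functions on lists of vectors. The product is the signed
  shuffle product, and associativity, graded commutativity and the Leibniz rule for \<open>d\<close> follow from
  the recursion by induction on the list of vectors. Multilinearity and skew-symmetry enter only to
  see that \<open>e\<^sup>B \<and> \<omega>\<close> is again a form and that \<open>B\<close> is reversed to \<open>-B\<close>.
\<close>

section \<open>The algebra of the wedge product\<close>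

definition grade_inv :: "'v ext \<Rightarrow> 'v ext" where
  "grade_inv a = (\<lambda>vs. (-1) ^ length vs * a vs)"

abbreviation even_ext :: "'v ext \<Rightarrow> bool" where
  "even_ext a \<equiv> grade_inv a = a"

abbreviation odd_ext :: "'v ext \<Rightarrow> bool" where
  "odd_ext a \<equiv> grade_inv a = - a"

lemma wedge_Nil [simp]: "(a \<and>\<^sub>w b) [] = a [] * b []"
  by (simp add: wedge_def shuffle_sign_def)

lemma shuffle_sign_insert_0:
  "shuffle_sign (Suc n) (insert 0 (Suc ` J)) = shuffle_sign n J"
proof -
  have "bij_betw (\<lambda>(i, j). (Suc i, Suc j))
      {(i, j). i \<in> J \<and> j \<in> {..<n} - J \<and> j < i}
      {(i, j). i \<in> insert 0 (Suc ` J) \<and> j \<in> {..<Suc n} - insert 0 (Suc ` J) \<and> j < i}"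
    by (rule bij_betw_byWitness[where f' = "\<lambda>(i, j). (i - 1, j - 1)"])
       (auto simp: image_iff gr0_conv_Suc less_Suc_eq_0_disj)
  from bij_betw_same_card[OF this] show ?thesis
    by (simp only: shuffle_sign_def)
qed

lemma shuffle_sign_image_Suc:
  assumes "J \<subseteq> {..<n}"
  shows "shuffle_sign (Suc n) (Suc ` J) = (-1) ^ card J * shuffle_sign n J"
proof -
  let ?S = "{(i, j). i \<in> J \<and> j \<in> {..<n} - J \<and> j < i}"
  have fin: "finite J" using assms finite_subset by blast
  have S: "finite ?S"
    by (rule finite_subset[of _ "J \<times> {..<n}"]) (use fin in auto)
  \<comment> \<open>The new inversions are those of position 0, which goes to the right, with all of \<open>J\<close>.\<close>
  have eq: "{(i, j). i \<in> Suc ` J \<and> j \<in> {..<Suc n} - Suc ` J \<and> j < i} =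
      (\<lambda>i. (Suc i, 0)) ` J \<union> (\<lambda>(i, j). (Suc i, Suc j)) ` ?S"
  proof (intro set_eqI iffI)
    fix x assume "x \<in> {(i, j). i \<in> Suc ` J \<and> j \<in> {..<Suc n} - Suc ` J \<and> j < i}"
    then obtain i j where x: "x = (Suc i, j)" "i \<in> J" "j < Suc n" "j \<notin> Suc ` J" "j < Suc i"
      by auto
    then show "x \<in> (\<lambda>i. (Suc i, 0)) ` J \<union> (\<lambda>(i, j). (Suc i, Suc j)) ` ?S"
      by (cases j) (force simp: image_iff)+
  qed auto
  have "card ((\<lambda>i. (Suc i, 0::nat)) ` J \<union> (\<lambda>(i, j). (Suc i, Suc j)) ` ?S) = card J + card ?S"
    using fin S by (subst card_Un_disjoint) (auto simp: card_image inj_on_def)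
  then show ?thesis
    unfolding shuffle_sign_def eq by (simp only: power_add)
qed

text \<open>
  In the sum over shuffles, the first vector goes either to the left factor, where it creates no
  inversion, or to the right one, where it is passed by every vector going to the left factor; this
  is the sign of \<open>grade_inv\<close>.
\<close>

lemma wedge_Cons:
  "(a \<and>\<^sub>w b) (v # vs) = (interior v a \<and>\<^sub>w b) vs + (grade_inv a \<and>\<^sub>w interior v b) vs"
proof -
  let ?n = "length vs"
  let ?F = "\<lambda>I. shuffle_sign (Suc ?n) I * a (nths (v # vs) I) * b (nths (v # vs) (- I))"
  have Pow: "Pow {..<Suc ?n} =
      (\<lambda>J. insert 0 (Suc ` J)) ` Pow {..<?n} \<union> (`) Suc ` Pow {..<?n}"
  proof -
    have "Pow (Suc ` {..<?n}) = (`) Suc ` Pow {..<?n}"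
      by (rule image_Pow_surj[symmetric]) simp
    then show ?thesis
      unfolding lessThan_Suc_eq_insert_0 Pow_insert by (auto simp: image_image)
  qed
  have disj: "(\<lambda>J. insert 0 (Suc ` J)) ` Pow {..<?n} \<inter> (`) Suc ` Pow {..<?n} = {}"
    by auto
  have inj1: "inj_on (\<lambda>J. insert 0 (Suc ` J)) (Pow {..<?n})"
  proof (rule inj_onI)
    fix J K assume "insert 0 (Suc ` J) = insert 0 (Suc ` K)"
    then have "Suc ` J = Suc ` K" by (auto simp: set_eq_iff)
    then show "J = K" by (simp add: inj_image_eq_iff)
  qed
  have inj2: "inj_on ((`) Suc) (Pow {..<?n})"
    by (rule inj_onI) (simp add: inj_image_eq_iff)
  have shift: "{j. Suc j \<in> insert 0 (Suc ` J)} = J" "{j. Suc j \<in> Suc ` J} = J"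
      "{j. Suc j \<notin> insert 0 (Suc ` J)} = - J" "{j. Suc j \<notin> Suc ` J} = - J" for J
    by auto
  have len: "length (nths vs J) = card J" if "J \<subseteq> {..<?n}" for J
    using that by (auto simp: length_nths intro!: arg_cong[where f = card])
  have "(a \<and>\<^sub>w b) (v # vs) = sum ?F (Pow {..<Suc ?n})"
    by (simp add: wedge_def)
  also have "\<dots> = (\<Sum>J\<in>Pow {..<?n}. ?F (insert 0 (Suc ` J))) + (\<Sum>J\<in>Pow {..<?n}. ?F (Suc ` J))"
    unfolding Pow
    by (subst sum.union_disjoint) (simp_all add: disj sum.reindex[OF inj1] sum.reindex[OF inj2])
  also have "(\<Sum>J\<in>Pow {..<?n}. ?F (insert 0 (Suc ` J))) = (interior v a \<and>\<^sub>w b) vs"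
    unfolding wedge_def
    by (rule sum.cong) (simp_all add: interior_def nths_Cons shift shuffle_sign_insert_0)
  also have "(\<Sum>J\<in>Pow {..<?n}. ?F (Suc ` J)) = (grade_inv a \<and>\<^sub>w interior v b) vs"
    unfolding wedge_def
    by (rule sum.cong)
       (simp_all add: interior_def nths_Cons shift shuffle_sign_image_Suc grade_inv_def len)
  finally show ?thesis .
qed

lemma wedge_add_left: "(a + b) \<and>\<^sub>w c = a \<and>\<^sub>w c + b \<and>\<^sub>w c"
  by (rule ext) (simp add: wedge_def algebra_simps sum.distrib)

lemma wedge_add_right: "a \<and>\<^sub>w (b + c) = a \<and>\<^sub>w b + a \<and>\<^sub>w c"
  by (rule ext) (simp add: wedge_def algebra_simps sum.distrib)

lemma wedge_minus_left: "(- a) \<and>\<^sub>w b = - (a \<and>\<^sub>w b)"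
  by (rule ext) (simp add: wedge_def sum_negf)

lemma wedge_minus_right: "a \<and>\<^sub>w (- b) = - (a \<and>\<^sub>w b)"
  by (rule ext) (simp add: wedge_def sum_negf)

lemma wedge_diff_left: "(a - b) \<and>\<^sub>w c = a \<and>\<^sub>w c - b \<and>\<^sub>w c"
  by (rule ext) (simp add: wedge_def algebra_simps sum_subtractf)

lemma wedge_diff_right: "a \<and>\<^sub>w (b - c) = a \<and>\<^sub>w b - a \<and>\<^sub>w c"
  by (rule ext) (simp add: wedge_def algebra_simps sum_subtractf)

lemma wedge_zero_left [simp]: "0 \<and>\<^sub>w a = 0"
  by (rule ext) (simp add: wedge_def)

lemma wedge_zero_right [simp]: "a \<and>\<^sub>w 0 = 0"
  by (rule ext) (simp add: wedge_def)

lemma wedge_scale_right: "(a \<and>\<^sub>w (\<lambda>vs. z * b vs)) vs = z * (a \<and>\<^sub>w b) vs"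
  by (simp add: wedge_def sum_distrib_left ac_simps)

lemma wedge_sum_right:
  "(a \<and>\<^sub>w (\<lambda>ws. \<Sum>m\<in>M. x m ws)) vs = (\<Sum>m\<in>M. (a \<and>\<^sub>w x m) vs)"
  unfolding wedge_def by (subst sum.swap) (simp add: sum_distrib_left)

lemma length_nths_le: "length (nths xs I) \<le> length xs"
  using card_mono[of "{..<length xs}" "{i. i < length xs \<and> i \<in> I}"]
  by (auto simp: length_nths)

lemma wedge_cong_right:
  assumes "\<And>ws. length ws \<le> length vs \<Longrightarrow> b ws = b' ws"
  shows "(a \<and>\<^sub>w b) vs = (a \<and>\<^sub>w b') vs"
  unfolding wedge_def by (simp add: assms length_nths_le)

lemma interior_wedge:
  "interior v (a \<and>\<^sub>w b) = interior v a \<and>\<^sub>w b + grade_inv a \<and>\<^sub>w interior v b"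
  by (rule ext) (simp add: interior_def[of v "a \<and>\<^sub>w b"] wedge_Cons)

lemma grade_inv_interior: "grade_inv (interior v a) = - interior v (grade_inv a)"
  by (rule ext) (simp add: grade_inv_def interior_def)

lemma grade_inv_add: "grade_inv (a + b) = grade_inv a + grade_inv b"
  by (rule ext) (simp add: grade_inv_def algebra_simps)

lemma grade_inv_minus: "grade_inv (- a) = - grade_inv a"
  by (rule ext) (simp add: grade_inv_def)

lemma grade_inv_grade_inv [simp]: "grade_inv (grade_inv a) = a"
  by (rule ext) (simp add: grade_inv_def flip: mult.assoc power_add)

lemma interior_add: "interior v (a + b) = interior v a + interior v b"
  by (rule ext) (simp add: interior_def)

lemma interior_minus: "interior v (- a) = - interior v a"
  by (rule ext) (simp add: interior_def)

lemma ext_eqI_interior: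
  assumes "a [] = b []" and "\<And>v. interior v a = interior v b"
  shows "a = b"
proof
  fix vs :: "'a list"
  show "a vs = b vs"
    using assms(1) fun_cong[OF assms(2)] by (cases vs) (simp_all add: interior_def)
qed

lemma grade_inv_wedge: "grade_inv (a \<and>\<^sub>w b) = grade_inv a \<and>\<^sub>w grade_inv b"
proof
  fix vs
  show "grade_inv (a \<and>\<^sub>w b) vs = (grade_inv a \<and>\<^sub>w grade_inv b) vs"
  proof (induction vs arbitrary: a b)
    case (Cons v vs)
    have "grade_inv (a \<and>\<^sub>w b) (v # vs) = - grade_inv (interior v (a \<and>\<^sub>w b)) vs"
      by (simp add: grade_inv_def interior_def)
    also have "\<dots> = (interior v (grade_inv a \<and>\<^sub>w grade_inv b)) vs"
      unfolding interior_wedge grade_inv_add plus_fun_apply Cons.IH grade_inv_interior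
        wedge_minus_left wedge_minus_right by simp
    finally show ?case by (simp add: interior_def)
  qed (simp add: grade_inv_def)
qed

lemma wedge_assoc: "(a \<and>\<^sub>w b) \<and>\<^sub>w c = a \<and>\<^sub>w b \<and>\<^sub>w c"
proof
  fix vs
  show "((a \<and>\<^sub>w b) \<and>\<^sub>w c) vs = (a \<and>\<^sub>w b \<and>\<^sub>w c) vs"
    by (induction vs arbitrary: a b c)
       (simp_all add: wedge_Cons interior_wedge wedge_add_left wedge_add_right grade_inv_wedge)
qed

text \<open>
  An odd form becomes even on contraction and conversely, so the two parities have to be treated in
  one induction.
\<close>

lemma wedge_graded_commute:
  "(even_ext a \<longrightarrow> (a \<and>\<^sub>w b) vs = (b \<and>\<^sub>w a) vs) \<and>
   (odd_ext a \<longrightarrow> (a \<and>\<^sub>w b) vs = (grade_inv b \<and>\<^sub>w a) vs)"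
proof (induction vs arbitrary: a b)
  case (Cons v vs)
  show ?case
  proof (intro conjI impI)
    assume a: "even_ext a"
    then have "odd_ext (interior v a)" by (simp add: grade_inv_interior)
    then have 1: "(interior v a \<and>\<^sub>w b) vs = (grade_inv b \<and>\<^sub>w interior v a) vs" using Cons by blast
    have 2: "(a \<and>\<^sub>w interior v b) vs = (interior v b \<and>\<^sub>w a) vs" using Cons a by blast
    show "(a \<and>\<^sub>w b) (v # vs) = (b \<and>\<^sub>w a) (v # vs)"
      unfolding wedge_Cons a 1 2 by simp
  next
    assume a: "odd_ext a"
    then have "even_ext (interior v a)" by (simp add: grade_inv_interior interior_minus)
    then have 1: "(interior v a \<and>\<^sub>w b) vs = (b \<and>\<^sub>w interior v a) vs" using Cons by blast
    have 2: "(a \<and>\<^sub>w interior v b) vs = (grade_inv (interior v b) \<and>\<^sub>w a) vs"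
      using Cons a by blast
    show "(a \<and>\<^sub>w b) (v # vs) = (grade_inv b \<and>\<^sub>w a) (v # vs)"
      unfolding wedge_Cons a wedge_minus_left uminus_apply 1 2 grade_inv_interior
        grade_inv_grade_inv by simp
  qed
qed (simp add: grade_inv_def)

lemma even_ext_commute: "even_ext a \<Longrightarrow> a \<and>\<^sub>w b = b \<and>\<^sub>w a"
  using wedge_graded_commute by blast

lemma even_ext_left_commute: "even_ext a \<Longrightarrow> a \<and>\<^sub>w b \<and>\<^sub>w c = b \<and>\<^sub>w a \<and>\<^sub>w c"
  by (metis even_ext_commute wedge_assoc)

lemma even_ext_one: "even_ext ext_one"
  by (rule ext) (simp add: grade_inv_def ext_one_def)

lemma interior_ext_one: "interior v ext_one = 0"
  by (rule ext) (simp add: interior_def ext_one_def)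

lemma wedge_one_left [simp]: "ext_one \<and>\<^sub>w a = a"
proof
  fix vs show "(ext_one \<and>\<^sub>w a) vs = a vs"
    by (induction vs arbitrary: a)
       (simp_all add: ext_one_def wedge_Cons interior_ext_one even_ext_one, simp add: interior_def)
qed

section \<open>Exponentials\<close>

abbreviation ext_power :: "'v ext \<Rightarrow> nat \<Rightarrow> 'v ext" where
  "ext_power b m \<equiv> ((\<and>\<^sub>w) b ^^ m) ext_one"

lemma ext_power_eq_0:
  assumes "b [] = 0" and "length vs < m"
  shows "ext_power b m vs = 0"
  using assms(2)
proof (induction m arbitrary: vs)
  case (Suc m)
  have "b (nths vs I) * ext_power b m (nths vs (- I)) = 0" for I
  proof (cases "nths vs I = []")
    case False
    have "length (nths vs I) + length (nths vs (- I)) = length vs"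
    proof -
      have "card {i. i < length vs \<and> i \<in> I} + card {i. i < length vs \<and> i \<in> - I} =
          card ({i. i < length vs \<and> i \<in> I} \<union> {i. i < length vs \<and> i \<in> - I})"
        by (rule card_Un_disjoint[symmetric]) auto
      also have "{i. i < length vs \<and> i \<in> I} \<union> {i. i < length vs \<and> i \<in> - I} = {..<length vs}"
        by auto
      finally show ?thesis by (simp add: length_nths)
    qed
    moreover have "0 < length (nths vs I)" using False by simp
    ultimately have "length (nths vs (- I)) < m" using Suc.prems by linarith
    then show ?thesis using Suc.IH by simp
  qed (simp add: assms(1))
  then have "shuffle_sign k I * b (nths vs I) * ext_power b m (nths vs (- I)) = 0" for k I
    by (simp add: mult.assoc)
  then have "(b \<and>\<^sub>w ext_power b m) vs = 0"
    unfolding wedge_def[of b "ext_power b m"] by (intro sum.neutral ballI)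
  then show ?case by simp
qed simp

text \<open>
  The truncation may be taken at any bound above the number of vectors. This freedom is needed below,
  where the exponential is evaluated on lists of different lengths within one computation.
\<close>

lemma ext_exp_eq_sum:
  assumes "b [] = 0" and "length vs < N"
  shows "ext_exp b vs = (\<Sum>m<N. ext_power b m vs / fact m)"
  unfolding ext_exp_def
  by (rule suminf_finite) (use assms in \<open>auto simp: ext_power_eq_0\<close>)

lemma ext_exp_eq_sum_Suc:
  "b [] = 0 \<Longrightarrow> ext_exp b vs = (\<Sum>m<Suc (length vs). ext_power b m vs / fact m)"
  by (simp only: ext_exp_eq_sum[OF _ lessI])

lemma ext_exp_Nil: "b [] = 0 \<Longrightarrow> ext_exp b [] = 1"
  by (simp add: ext_exp_eq_sum[where N = 1] ext_one_def)

lemma even_ext_power: "even_ext b \<Longrightarrow> even_ext (ext_power b m)"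
  by (induction m) (simp_all add: even_ext_one grade_inv_wedge)

lemma even_ext_exp:
  assumes "b [] = 0" "even_ext b"
  shows "even_ext (ext_exp b)"
proof
  fix vs
  have "(-1) ^ length vs * ext_power b m vs = ext_power b m vs" for m
    using fun_cong[OF even_ext_power[OF assms(2)], of m vs] by (simp add: grade_inv_def)
  then show "grade_inv (ext_exp b) vs = ext_exp b vs"
    by (simp only: grade_inv_def ext_exp_eq_sum_Suc[of b, OF assms(1)] sum_distrib_left
        times_divide_eq_right)
qed

text \<open>
  The abstract form of \<open>D(b\<^sup>m\<^sup>+\<^sup>1) = (m + 1) Db \<and> b\<^sup>m\<close>. The sequence \<open>f\<close> stands for \<open>D(b\<^sup>m)\<close> and \<open>e\<close>
  for \<open>Db\<close>; only these values are mentioned, so that the lemma covers both contractions, which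
  act on forms, and the exterior derivative, which acts on fields of forms.
\<close>

lemma derivation_of_powers:
  assumes "even_ext b" and "f 0 = 0" and "\<And>m. f (Suc m) = e \<and>\<^sub>w ext_power b m + b \<and>\<^sub>w f m"
  shows "f (Suc m) = (\<lambda>vs. of_nat (Suc m) * (e \<and>\<^sub>w ext_power b m) vs)"
proof (induction m)
  case 0
  show ?case by (simp add: assms(2, 3))
next
  case (Suc m)
  have eb: "b \<and>\<^sub>w e \<and>\<^sub>w ext_power b m = e \<and>\<^sub>w ext_power b (Suc m)"
    by (simp add: even_ext_left_commute[OF assms(1), of e])
  show ?case
  proof
    fix vs
    have "f (Suc (Suc m)) vs =
        (e \<and>\<^sub>w ext_power b (Suc m)) vs + of_nat (Suc m) * (b \<and>\<^sub>w e \<and>\<^sub>w ext_power b m) vs"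
      by (simp only: assms(3)[of "Suc m"] Suc plus_fun_apply wedge_scale_right)
    then show "f (Suc (Suc m)) vs = of_nat (Suc (Suc m)) * (e \<and>\<^sub>w ext_power b (Suc m)) vs"
      unfolding eb by (simp add: algebra_simps)
  qed
qed

text \<open>
  In the notation of the previous lemma, \<open>D(e\<^sup>b) = Db \<and> e\<^sup>b\<close>.
\<close>

lemma derivation_of_exp:
  assumes "even_ext b" and "b [] = 0"
    and "f 0 = 0" and "\<And>m. f (Suc m) = e \<and>\<^sub>w ext_power b m + b \<and>\<^sub>w f m"
    and "length vs < N"
  shows "(\<Sum>m<Suc N. f m vs / fact m) = (e \<and>\<^sub>w ext_exp b) vs"
proof -
  have "(\<Sum>m<Suc N. f m vs / fact m) = (\<Sum>m<N. (1 / fact m) * (e \<and>\<^sub>w ext_power b m) vs)"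
    unfolding sum.lessThan_Suc_shift
    by (simp add: assms(3) derivation_of_powers[OF assms(1, 3, 4)] field_simps del: of_nat_Suc)
  also have "\<dots> = (e \<and>\<^sub>w (\<lambda>ws. \<Sum>m<N. (1 / fact m) * ext_power b m ws)) vs"
    by (simp only: wedge_sum_right wedge_scale_right)
  also have "\<dots> = (e \<and>\<^sub>w ext_exp b) vs"
    by (rule wedge_cong_right) (use assms in \<open>simp add: ext_exp_eq_sum[where N = N]\<close>)
  finally show ?thesis .
qed

lemma interior_exp:
  assumes "even_ext b" and "b [] = 0"
  shows "interior v (ext_exp b) = interior v b \<and>\<^sub>w ext_exp b"
proof
  fix vs
  have "interior v (ext_exp b) vs =
      (\<Sum>m<Suc (Suc (length vs)). interior v (ext_power b m) vs / fact m)"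
    unfolding interior_def by (rule ext_exp_eq_sum) (simp_all add: assms)
  also have "\<dots> = (interior v b \<and>\<^sub>w ext_exp b) vs"
    by (rule derivation_of_exp[where f = "\<lambda>m. interior v (ext_power b m)"])
       (simp_all only: assms interior_ext_one interior_wedge funpow.simps o_apply id_apply
         lessI)
  finally show "interior v (ext_exp b) vs = (interior v b \<and>\<^sub>w ext_exp b) vs" .
qed

text \<open>
  Both sides take the value 1 on the empty list, and every contraction of the left-hand side
  vanishes, because the two contributions \<open>\<iota>\<^sub>vb\<close> from the exponentials cancel.
\<close>

lemma ext_exp_inverse:
  assumes "even_ext b" and "b [] = 0"
  shows "ext_exp (- b) \<and>\<^sub>w ext_exp b = ext_one"
proof (rule ext_eqI_interior)
  show "(ext_exp (- b) \<and>\<^sub>w ext_exp b) [] = ext_one []"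
    using assms by (simp add: ext_exp_Nil ext_one_def)
next
  fix v
  have b': "even_ext (- b)" "(- b) [] = 0" using assms by (simp_all add: grade_inv_minus)
  have "interior v (ext_exp (- b) \<and>\<^sub>w ext_exp b) =
      - (interior v b \<and>\<^sub>w ext_exp (- b)) \<and>\<^sub>w ext_exp b + ext_exp (- b) \<and>\<^sub>w interior v b \<and>\<^sub>w ext_exp b"
    using assms b' by (simp add: interior_wedge interior_exp even_ext_exp interior_minus
        wedge_minus_left)
  also have "\<dots> = 0"
    by (simp add: wedge_minus_left wedge_assoc even_ext_left_commute[OF even_ext_exp[OF b'(2,1)]])
  finally show "interior v (ext_exp (- b) \<and>\<^sub>w ext_exp b) = interior v ext_one"
    by (simp add: interior_ext_one)
qed

lemma reversal_exp:
  assumes "even_ext b" and "b [] = 0"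
  shows "reversal (ext_exp b) = ext_exp (reversal b)"
proof
  fix vs
  have r: "even_ext (reversal b)"
    using fun_cong[OF assms(1), of "rev _"] by (auto simp: grade_inv_def reversal_def)
  have p: "reversal (ext_power b m) = ext_power (reversal b) m" for m
  proof (induction m)
    case 0
    show ?case by (rule ext) (simp add: reversal_def ext_one_def)
  next
    case (Suc m)
    then show ?case using even_ext_commute[OF r] by (simp add: reversal_wedge)
  qed
  have "ext_power b m (rev vs) = ext_power (reversal b) m vs" for m
    using fun_cong[OF p] by (simp add: reversal_def)
  then show "reversal (ext_exp b) vs = ext_exp (reversal b) vs"
    by (simp add: reversal_def ext_exp_def)
qed

section \<open>Alternating forms\<close>

definition multilinear :: "'v::real_vector ext \<Rightarrow> bool" where
  "multilinear a \<longleftrightarrow> (\<forall>us ws. linear (\<lambda>v. a (us @ v # ws)))"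

text \<open>
  Exchange of adjacent arguments is used in place of the vanishing on lists with repetitions because
  it says that contractions anticommute, which passes to wedge products by \<open>wedge_Cons\<close>.
\<close>

definition skew :: "'v ext \<Rightarrow> bool" where
  "skew a \<longleftrightarrow> (\<forall>us v w ws. a (us @ v # w # ws) = - a (us @ w # v # ws))"

lemma skew_eq_0:
  assumes "skew a" and "\<not> distinct vs"
  shows "a vs = 0"
proof -
  have "a (us @ v # xs @ v # ws) = 0" for us v xs ws
  proof (induction xs arbitrary: us)
    case Nil
    have "a (us @ v # v # ws) = - a (us @ v # v # ws)"
      using assms(1) unfolding skew_def by blast
    then show ?case by simp
  next
    case (Cons x xs)
    have "a (us @ v # x # xs @ v # ws) = - a (us @ x # v # xs @ v # ws)"
      using assms(1) unfolding skew_def by blast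
    also have "\<dots> = 0" using Cons[of "us @ [x]"] by simp
    finally show ?case by simp
  qed
  with not_distinct_decomp[OF assms(2)] show ?thesis by force
qed

lemma alternating_skew:
  assumes "alternating a"
  shows "skew a"
  unfolding skew_def
proof (intro allI)
  fix us v w ws
  have z: "a (us @ x # x # ws) = 0" for x using assms by (simp add: alternating_def)
  have l1: "linear (\<lambda>x. a (us @ x # y # ws))" for y
    using assms unfolding alternating_def by blast
  have l2: "linear (\<lambda>x. a (us @ y # x # ws))" for y
  proof -
    have "linear (\<lambda>x. a ((us @ [y]) @ x # ws))" using assms unfolding alternating_def by blast
    then show ?thesis by simp
  qed
  show "a (us @ v # w # ws) = - a (us @ w # v # ws)"
    using z[of "v + w"] linear_add[OF l1, of v w "v + w"] linear_add[OF l2, of v v w]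
      linear_add[OF l2, of w v w] by (simp add: z add_eq_0_iff)
qed

lemma alternating_iff: "alternating a \<longleftrightarrow> multilinear a \<and> skew a"
  using alternating_skew skew_eq_0 by (auto simp: alternating_def multilinear_def)

lemma linear_sum_fun:
  "(\<And>i. i \<in> I \<Longrightarrow> linear (f i)) \<Longrightarrow> linear (\<lambda>v. \<Sum>i\<in>I. f i v)"
  by (rule linear_compose_sum) simp

lemma linear_mult_const:
  fixes f :: "'v::real_vector \<Rightarrow> complex"
  assumes "linear f"
  shows "linear (\<lambda>v. z * f v)" "linear (\<lambda>v. f v * z)"
  by (rule linearI; simp add: linear_add[OF assms] linear_cmul[OF assms] algebra_simps)+

lemma multilinear_wedge:
  assumes "multilinear a" and "multilinear b"
  shows "multilinear (a \<and>\<^sub>w b)"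
proof -
  have "linear (\<lambda>v. (a \<and>\<^sub>w b) (us @ v # ws))" for us ws
    using assms
  proof (induction us arbitrary: a b)
    case Nil
    have l: "linear (\<lambda>v. interior v x vs)" if "multilinear x" for x :: "'a ext" and vs
      using that[unfolded multilinear_def, rule_format, of "[]" vs] by (simp add: interior_def)
    show ?case
      unfolding append_Nil wedge_Cons unfolding wedge_def
      by (intro linear_compose_add linear_sum_fun linear_mult_const l Nil)
  next
    case (Cons u us)
    have "multilinear (interior u x)" if "multilinear x" for x :: "'a ext"
      using that[unfolded multilinear_def, rule_format, of "u # vs" for vs]
      by (simp add: multilinear_def interior_def)
    moreover have "multilinear (grade_inv x)" if "multilinear x" for x :: "'a ext"
      using that unfolding multilinear_def grade_inv_def length_append list.size
      by (intro allI linear_mult_const) blast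
    ultimately show ?case
      by (simp add: wedge_Cons linear_compose_add Cons)
  qed
  then show ?thesis by (simp add: multilinear_def)
qed

lemma skew_wedge:
  assumes "skew a" and "skew b"
  shows "skew (a \<and>\<^sub>w b)"
proof -
  have "(a \<and>\<^sub>w b) (us @ v # w # ws) = - (a \<and>\<^sub>w b) (us @ w # v # ws)" for us v w ws
    using assms
  proof (induction us arbitrary: a b)
    case Nil
    have s: "interior w (interior v x) = - interior v (interior w x)" if "skew x" for x :: "'a ext"
    proof
      fix vs
      show "interior w (interior v x) vs = (- interior v (interior w x)) vs"
        using that[unfolded skew_def, rule_format, of "[]" v w vs] by (simp add: interior_def)
    qed
    show ?case
      by (simp add: wedge_Cons s[OF Nil(1)] s[OF Nil(2)] grade_inv_interior wedge_minus_left
          wedge_minus_right)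
  next
    case (Cons u us)
    have "skew (interior u x)" if "skew x" for x :: "'a ext"
      using that[unfolded skew_def, rule_format, of "u # vs" for vs]
      unfolding skew_def interior_def append_Cons by blast
    moreover have "skew (grade_inv x)" if "skew x" for x :: "'a ext"
      unfolding skew_def
    proof (intro allI)
      fix us v w ws
      have "x (us @ v # w # ws) = - x (us @ w # v # ws)" using that unfolding skew_def by blast
      then show "grade_inv x (us @ v # w # ws) = - grade_inv x (us @ w # v # ws)"
        by (simp add: grade_inv_def)
    qed
    ultimately show ?case by (simp add: wedge_Cons Cons)
  qed
  then show ?thesis unfolding skew_def by blast
qed

lemma alternating_wedge: "alternating a \<Longrightarrow> alternating b \<Longrightarrow> alternating (a \<and>\<^sub>w b)"
  by (simp add: alternating_iff multilinear_wedge skew_wedge)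

lemma alternating_exp:
  assumes "alternating b" and nil: "b [] = 0"
  shows "alternating (ext_exp b)"
proof -
  have one: "alternating (ext_one :: 'a ext)"
    by (auto simp: alternating_def ext_one_def linear_zero)
  have p: "alternating (ext_power b m)" for m
    by (induction m) (simp_all add: one alternating_wedge assms)
  show ?thesis
    unfolding alternating_def
  proof (intro conjI allI impI)
    fix us ws :: "'a list"
    have "linear (\<lambda>v. \<Sum>m<Suc (Suc (length us + length ws)). ext_power b m (us @ v # ws) / fact m)"
      unfolding divide_inverse
      by (intro linear_sum_fun linear_mult_const) (use p in \<open>simp add: alternating_def\<close>)
    then show "linear (\<lambda>v. ext_exp b (us @ v # ws))"
      by (simp add: ext_exp_eq_sum_Suc[of b, OF nil])
  next
    fix vs :: "'a list" assume "\<not> distinct vs"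
    then have "ext_power b m vs = 0" for m using p by (auto simp: alternating_def)
    then show "ext_exp b vs = 0" by (simp add: ext_exp_def)
  qed
qed

section \<open>Local representatives of forms\<close>

lemma forms_zero: "\<omega> \<in> forms A \<Longrightarrow> \<not> (c \<in> A \<and> p \<in> chart_image c) \<Longrightarrow> \<omega> c p = 0"
  unfolding forms_def by blast

lemma forms_alternating:
  "\<omega> \<in> forms A \<Longrightarrow> c \<in> A \<Longrightarrow> p \<in> chart_image c \<Longrightarrow> alternating (\<omega> c p)"
  unfolding forms_def by blast

lemma forms_smooth: "\<omega> \<in> forms A \<Longrightarrow> c \<in> A \<Longrightarrow> smooth_on (chart_image c) (\<lambda>p. \<omega> c p vs)"
  unfolding forms_def by blast

lemma forms_pullback:
  "\<omega> \<in> forms A \<Longrightarrow> c \<in> A \<Longrightarrow> c' \<in> A \<Longrightarrow> p \<in> overlap c c' \<Longrightarrow>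
    \<omega> c' (transition c c' p) (map (D_transition c c' p) vs) = \<omega> c p vs"
  unfolding forms_def mem_Collect_eq by metis

lemma real_forms_forms: "\<omega> \<in> real_forms k A \<Longrightarrow> \<omega> \<in> forms A"
  by (simp add: real_forms_def)

lemma real_forms_real: "\<omega> \<in> real_forms k A \<Longrightarrow> \<omega> c p vs \<in> \<real>"
  unfolding real_forms_def by blast

lemma real_forms_degree: "\<omega> \<in> real_forms k A \<Longrightarrow> length vs \<noteq> k \<Longrightarrow> \<omega> c p vs = 0"
  unfolding real_forms_def by blast

section \<open>The star operator of a B-field transform\<close>

text \<open>
  Skew-symmetry without linearity: this is all that the parity and the reversal of \<open>b\<close> depend on,
  and it holds also where a form is extended by zero.
\<close>

definition two_form :: "'v ext \<Rightarrow> bool" where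
  "two_form b \<longleftrightarrow> (\<forall>vs. length vs \<noteq> 2 \<longrightarrow> b vs = 0) \<and> (\<forall>v w. b [v, w] = - b [w, v])"

lemma two_form_degree: "two_form b \<Longrightarrow> length vs \<noteq> 2 \<Longrightarrow> b vs = 0"
  by (simp add: two_form_def)

lemma two_form_swap: "two_form b \<Longrightarrow> b [v, w] = - b [w, v]"
  unfolding two_form_def by blast

lemma two_form_Nil: "two_form b \<Longrightarrow> b [] = 0"
  by (simp add: two_form_degree)

lemma two_form_even:
  assumes "two_form b"
  shows "even_ext b"
proof
  fix vs
  show "grade_inv b vs = b vs"
    using two_form_degree[OF assms, of vs] by (cases "length vs = 2") (simp_all add: grade_inv_def)
qed

lemma two_form_uminus: "two_form b \<Longrightarrow> two_form (- b)"
  unfolding two_form_def uminus_apply by (metis minus_zero)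

lemma reversal_two_form:
  assumes "two_form b"
  shows "reversal b = - b"
proof
  fix vs :: "'a list"
  show "reversal b vs = (- b) vs"
  proof (cases "length vs = 2")
    case True
    then obtain v w where "vs = [v, w]" by (auto simp: numeral_2_eq_2 length_Suc_conv)
    then show ?thesis using two_form_swap[OF assms, of w v] by (simp add: reversal_def)
  qed (simp add: two_form_degree[OF assms] reversal_def)
qed

text \<open>
  Moving \<open>\<iota>\<^sub>v\<close> past \<open>e\<^sup>b\<close> produces the term \<open>\<iota>\<^sub>vb \<and> e\<^sup>b\<close>, which is the contribution of \<open>b\<close> to \<open>e_hat\<close>.
\<close>

lemma exp_wedge_e_hat:
  assumes b: "two_form b"
  shows "ext_exp b \<and>\<^sub>w e_hat h b v a = e_hat h 0 v (ext_exp b \<and>\<^sub>w a)"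
proof -
  note b' = two_form_even[OF b] two_form_Nil[OF b]
  note E = even_ext_exp[OF b'(2,1)]
  let ?t = "one_form (\<lambda>w. complex_of_real (h v w))"
  have iv: "interior v b = one_form (\<lambda>w. b [v, w])"
    by (rule ext) (simp add: interior_def one_form_def two_form_degree[OF b] split: list.split)
  have "one_form (\<lambda>w. complex_of_real (h v w) + b [v, w]) = ?t + interior v b"
    unfolding iv by (rule ext) (simp add: one_form_def split: list.split)
  then have "ext_exp b \<and>\<^sub>w e_hat h b v a =
      ext_exp b \<and>\<^sub>w interior v a + ext_exp b \<and>\<^sub>w ?t \<and>\<^sub>w a + ext_exp b \<and>\<^sub>w interior v b \<and>\<^sub>w a"
    by (simp add: e_hat_def wedge_add_left wedge_add_right add.assoc)
  also have "\<dots> = interior v (ext_exp b \<and>\<^sub>w a) + ?t \<and>\<^sub>w ext_exp b \<and>\<^sub>w a"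
    by (simp add: interior_wedge interior_exp b' E wedge_assoc
        even_ext_left_commute[OF E, of ?t] even_ext_left_commute[OF E, of "interior v b"])
  finally show ?thesis by (simp add: e_hat_def)
qed

lemma exp_wedge_fold_e_hat:
  assumes "two_form b"
  shows "ext_exp b \<and>\<^sub>w fold (\<lambda>i. e_hat h b (e i)) is a =
    fold (\<lambda>i. e_hat h 0 (e i)) is (ext_exp b \<and>\<^sub>w a)"
  by (induction "is" arbitrary: a) (simp_all add: exp_wedge_e_hat[OF assms])

text \<open>
  The equality of the integrands of the two pairings. The product of the operators \<open>e_hat\<close> for \<open>b\<close> is
  \<open>e\<^sup>-\<^sup>b\<close> times the product for 0 applied to \<open>e\<^sup>b \<and> a'\<close>; under the reversal \<open>e\<^sup>-\<^sup>b\<close> becomes a factor \<open>e\<^sup>b\<close>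
  on the right, which is even and hence can be moved to the far left.
\<close>

lemma wedge_reversal_fold_e_hat:
  assumes b: "two_form b"
  shows "a \<and>\<^sub>w reversal (fold (\<lambda>i. e_hat h b (e i)) is a') =
    (ext_exp b \<and>\<^sub>w a) \<and>\<^sub>w reversal (fold (\<lambda>i. e_hat h 0 (e i)) is (ext_exp b \<and>\<^sub>w a'))"
proof -
  note b' = two_form_even[OF b] two_form_Nil[OF b]
  note c = two_form_uminus[OF b]
  let ?F = "fold (\<lambda>i. e_hat h b (e i)) is a'"
  let ?S = "fold (\<lambda>i. e_hat h 0 (e i)) is (ext_exp b \<and>\<^sub>w a')"
  have "?F = ext_exp (- b) \<and>\<^sub>w ext_exp b \<and>\<^sub>w ?F"
    by (simp add: ext_exp_inverse[OF b'] flip: wedge_assoc)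
  also have "\<dots> = ext_exp (- b) \<and>\<^sub>w ?S"
    by (simp add: exp_wedge_fold_e_hat[OF b])
  finally have "reversal ?F = reversal ?S \<and>\<^sub>w reversal (ext_exp (- b))"
    by (simp add: reversal_wedge)
  also have "reversal (ext_exp (- b)) = ext_exp b"
    by (simp add: reversal_exp two_form_even[OF c] two_form_Nil[OF b] reversal_two_form[OF c])
  finally have F: "reversal ?F = reversal ?S \<and>\<^sub>w ext_exp b" .
  show ?thesis
    unfolding F wedge_assoc even_ext_commute[OF even_ext_exp[OF b'(2,1)], of "a \<and>\<^sub>w reversal ?S"] ..
qed

lemma cnj_wedge: "cnj ((a \<and>\<^sub>w b) vs) = ((\<lambda>vs. cnj (a vs)) \<and>\<^sub>w (\<lambda>vs. cnj (b vs))) vs"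
  by (simp add: wedge_def shuffle_sign_def)

lemma cnj_exp:
  assumes "\<And>vs. b vs \<in> \<real>" and "b [] = 0"
  shows "cnj (ext_exp b vs) = ext_exp b vs"
proof -
  have b: "(\<lambda>vs. cnj (b vs)) = b"
    using assms(1) by (auto simp: Reals_cnj_iff)
  have "(\<lambda>vs. cnj (ext_power b m vs)) = ext_power b m" for m
    by (induction m) (auto simp: ext_one_def cnj_wedge b)
  then have "cnj (ext_power b m vs) = ext_power b m vs" for m
    by (metis (no_types))
  then show ?thesis
    by (simp add: ext_exp_eq_sum_Suc[of b, OF assms(2)])
qed

lemma real_forms_two_form:
  assumes "B \<in> real_forms 2 A"
  shows "two_form (B c p)"
proof (cases "c \<in> A \<and> p \<in> chart_image c")
  case False
  have "B c p = 0" by (rule forms_zero[OF real_forms_forms[OF assms] False])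
  then show ?thesis by (simp add: two_form_def)
next
  case True
  then have alt: "alternating (B c p)" using forms_alternating[OF real_forms_forms[OF assms]] by blast
  have "B c p [v, w] = - B c p [w, v]" for v w
    using alternating_skew[OF alt, unfolded skew_def, rule_format, of "[]" v w "[]"] by simp
  moreover have "B c p vs = 0" if "length vs \<noteq> 2" for vs
    using assms that by (rule real_forms_degree)
  ultimately show ?thesis unfolding two_form_def by blast
qed

text \<open>
  The frame chosen in the star operator depends on the metric alone, so both sides use the same one.
  Complex conjugation commutes with \<open>e\<^sup>B\<close> as \<open>B\<close> is real.
\<close>

lemma BI_inner_eq_L2_inner:
  assumes B: "B \<in> real_forms 2 A"
  shows "L2_inner X A g (eps B \<omega>) (eps B \<omega>') = BI_inner X A g B \<omega> \<omega>'"
proof -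
  have conj: "conj_form (eps B \<omega>') c p = ext_exp (B c p) \<and>\<^sub>w conj_form \<omega>' c p" for c p
    by (rule ext) (simp add: conj_form_def eps_def cnj_wedge
        cnj_exp[OF real_forms_real[OF B] real_forms_degree[OF B]])
  have "form_wedge \<omega> (BI_star g B (conj_form \<omega>')) =
      form_wedge (eps B \<omega>) (BI_star g 0 (conj_form (eps B \<omega>')))"
    by (intro ext)
       (simp add: form_wedge_def BI_star_def Let_def conj zero_fun_def[symmetric] eps_def[of B \<omega>]
         wedge_reversal_fold_e_hat[OF real_forms_two_form[OF B]])
  then show ?thesis by (simp add: L2_inner_def BI_inner_def)
qed

section \<open>The exterior derivative\<close>

text \<open>
  The exterior derivative in one chart, on fields of arbitrary functions on lists of vectors, so that
  contraction with a constant vector field stays within its domain.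
\<close>

definition field_deriv ::
    "('v::real_normed_vector \<Rightarrow> 'v ext) \<Rightarrow> 'v \<Rightarrow> 'v ext" where
  "field_deriv a p vs = (\<Sum>i<length vs. (-1) ^ i *
     frechet_derivative (\<lambda>q. a q (take i vs @ drop (Suc i) vs)) (at p) (vs ! i))"

definition coeffs_differentiable ::
    "('v::real_normed_vector \<Rightarrow> 'v ext) \<Rightarrow> 'v \<Rightarrow> bool" where
  "coeffs_differentiable a p \<longleftrightarrow> (\<forall>vs. (\<lambda>q. a q vs) differentiable (at p))"

definition dir_deriv ::
    "('v::real_normed_vector \<Rightarrow> 'v ext) \<Rightarrow> 'v \<Rightarrow> 'v \<Rightarrow> 'v ext" where
  "dir_deriv a p v = (\<lambda>vs. frechet_derivative (\<lambda>q. a q vs) (at p) v)"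

text \<open>
  Cartan's formula for a constant vector field. Together with \<open>wedge_Cons\<close> it reduces identities for
  the exterior derivative to shorter lists.
\<close>

lemma interior_field_deriv:
  "interior v (field_deriv a p) = dir_deriv a p v - field_deriv (\<lambda>q. interior v (a q)) p"
  by (rule ext)
     (simp add: field_deriv_def interior_def dir_deriv_def sum.lessThan_Suc_shift sum_negf
       del: sum.lessThan_Suc)

lemma wedge_has_derivative:
  assumes "coeffs_differentiable a p" and "coeffs_differentiable b p"
  shows "((\<lambda>q. (a q \<and>\<^sub>w b q) vs) has_derivative
    (\<lambda>v. (dir_deriv a p v \<and>\<^sub>w b p) vs + (a p \<and>\<^sub>w dir_deriv b p v) vs)) (at p)"
proof -
  have d: "((\<lambda>q. x q vs) has_derivative (\<lambda>v. dir_deriv x p v vs)) (at p)"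
    if "coeffs_differentiable x p" for x :: "'a \<Rightarrow> 'a ext" and vs
    using that by (simp add: coeffs_differentiable_def dir_deriv_def frechet_derivative_works[symmetric])
  have "((\<lambda>q. (a q \<and>\<^sub>w b q) vs) has_derivative
     (\<lambda>v. \<Sum>I\<in>Pow {..<length vs}.
        (shuffle_sign (length vs) I * a p (nths vs I)) * dir_deriv b p v (nths vs (- I)) +
        (shuffle_sign (length vs) I * dir_deriv a p v (nths vs I)) * b p (nths vs (- I)))) (at p)"
    unfolding wedge_def
    by (intro has_derivative_sum has_derivative_mult has_derivative_mult_right d assms)
  then show ?thesis
    by (simp add: wedge_def sum.distrib add.commute)
qed

lemma coeffs_differentiable_wedge:
  "coeffs_differentiable a p \<Longrightarrow> coeffs_differentiable b p \<Longrightarrow>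
    coeffs_differentiable (\<lambda>q. a q \<and>\<^sub>w b q) p"
  unfolding coeffs_differentiable_def[of "\<lambda>q. a q \<and>\<^sub>w b q"] differentiable_def
  using wedge_has_derivative by blast

lemma dir_deriv_wedge:
  assumes "coeffs_differentiable a p" and "coeffs_differentiable b p"
  shows "dir_deriv (\<lambda>q. a q \<and>\<^sub>w b q) p v = dir_deriv a p v \<and>\<^sub>w b p + a p \<and>\<^sub>w dir_deriv b p v"
  unfolding dir_deriv_def[of "\<lambda>q. a q \<and>\<^sub>w b q"]
  by (rule ext) (simp add: frechet_derivative_at[OF wedge_has_derivative[OF assms], symmetric])

lemma coeffs_differentiable_interior:
  "coeffs_differentiable a p \<Longrightarrow> coeffs_differentiable (\<lambda>q. interior v (a q)) p"
  by (simp add: coeffs_differentiable_def interior_def)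

lemma coeffs_differentiable_grade_inv:
  "coeffs_differentiable a p \<Longrightarrow> coeffs_differentiable (\<lambda>q. grade_inv (a q)) p"
  unfolding coeffs_differentiable_def grade_inv_def
  by (intro allI differentiable_mult differentiable_const) auto

lemma coeffs_differentiable_exp:
  assumes b: "coeffs_differentiable b p" and "\<And>q. b q [] = 0"
  shows "coeffs_differentiable (\<lambda>q. ext_power (b q) m) p"
    and "coeffs_differentiable (\<lambda>q. ext_exp (b q)) p"
proof -
  show *: "coeffs_differentiable (\<lambda>q. ext_power (b q) m) p" for m
    by (induction m) (use b in \<open>simp_all add: coeffs_differentiable_wedge, simp add: coeffs_differentiable_def\<close>)
  show "coeffs_differentiable (\<lambda>q. ext_exp (b q)) p"
    unfolding coeffs_differentiable_def
  proof
    fix vs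
    have "(\<lambda>q. \<Sum>m<Suc (length vs). ext_power (b q) m vs / fact m) differentiable (at p)"
      by (intro differentiable_sum differentiable_divide differentiable_const)
         (use * in \<open>auto simp: coeffs_differentiable_def\<close>)
    then show "(\<lambda>q. ext_exp (b q) vs) differentiable (at p)"
      by (simp add: ext_exp_eq_sum_Suc[of "b _", OF assms(2)])
  qed
qed

lemma field_deriv_add:
  assumes "coeffs_differentiable a p" "coeffs_differentiable b p"
  shows "field_deriv (\<lambda>q. a q + b q) p = field_deriv a p + field_deriv b p"
proof
  fix vs
  have "frechet_derivative (\<lambda>q. a q ws + b q ws) (at p) =
      (\<lambda>v. frechet_derivative (\<lambda>q. a q ws) (at p) v + frechet_derivative (\<lambda>q. b q ws) (at p) v)" for ws
    by (rule frechet_derivative_at[symmetric])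
       (use assms in \<open>auto intro!: has_derivative_add simp: coeffs_differentiable_def frechet_derivative_works[symmetric]\<close>)
  then show "field_deriv (\<lambda>q. a q + b q) p vs = (field_deriv a p + field_deriv b p) vs"
    by (simp add: field_deriv_def algebra_simps sum.distrib)
qed

lemma frechet_derivative_scale:
  fixes f :: "'v::real_normed_vector \<Rightarrow> complex"
  assumes "f differentiable (at p)"
  shows "frechet_derivative (\<lambda>q. z * f q) (at p) = (\<lambda>v. z * frechet_derivative f (at p) v)"
  by (rule frechet_derivative_at[symmetric])
     (use assms in \<open>auto intro!: has_derivative_mult_right simp: frechet_derivative_works[symmetric]\<close>)

lemma field_deriv_grade_inv:
  assumes "coeffs_differentiable a p"
  shows "field_deriv (\<lambda>q. grade_inv (a q)) p = - grade_inv (field_deriv a p)"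
proof
  fix vs :: "'a list"
  have "frechet_derivative (\<lambda>q. grade_inv (a q) (take i vs @ drop (Suc i) vs)) (at p) v =
      - ((-1) ^ length vs * frechet_derivative (\<lambda>q. a q (take i vs @ drop (Suc i) vs)) (at p) v)"
    if "i < length vs" for i v
  proof -
    have sign: "(-1) ^ (length vs - 1) = - ((-1) ^ length vs :: complex)"
      using that by (cases "length vs") auto
    have len: "length (take i vs @ drop (Suc i) vs) = length vs - 1" using that by simp
    have "(\<lambda>q. a q ws) differentiable (at p)" for ws
      using assms by (simp add: coeffs_differentiable_def)
    then show ?thesis
      unfolding grade_inv_def len sign by (subst frechet_derivative_scale) simp_all
  qed
  then show "field_deriv (\<lambda>q. grade_inv (a q)) p vs = (- grade_inv (field_deriv a p)) vs"
    by (simp add: field_deriv_def grade_inv_def[of "field_deriv a p"]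
        sum_distrib_left sum_negf algebra_simps)
qed

text \<open>
  By Cartan's formula and \<open>interior_wedge\<close>, the contraction of the left-hand side consists of the
  directional derivative of the product, given by the ordinary product rule, and of the exterior
  derivatives of \<open>\<iota>\<^sub>va \<and> b\<close> and \<open>grade_inv a \<and> \<iota>\<^sub>vb\<close>, to which the induction hypothesis applies.
\<close>

lemma field_deriv_wedge:
  assumes "coeffs_differentiable a p" and "coeffs_differentiable b p"
  shows "field_deriv (\<lambda>q. a q \<and>\<^sub>w b q) p =
    field_deriv a p \<and>\<^sub>w b p + grade_inv (a p) \<and>\<^sub>w field_deriv b p"
proof
  fix vs
  show "field_deriv (\<lambda>q. a q \<and>\<^sub>w b q) p vs =
    (field_deriv a p \<and>\<^sub>w b p + grade_inv (a p) \<and>\<^sub>w field_deriv b p) vs"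
    using assms
  proof (induction vs arbitrary: a b)
    case Nil
    then show ?case by (simp add: field_deriv_def)
  next
    case (Cons v vs)
    note a = Cons.prems(1) and b = Cons.prems(2)
    note [simp] = a b coeffs_differentiable_interior coeffs_differentiable_grade_inv
      coeffs_differentiable_wedge
    have "field_deriv (\<lambda>q. a q \<and>\<^sub>w b q) p (v # vs) =
        interior v (field_deriv (\<lambda>q. a q \<and>\<^sub>w b q) p) vs"
      by (simp add: interior_def)
    also have "\<dots> = (dir_deriv a p v \<and>\<^sub>w b p) vs + (a p \<and>\<^sub>w dir_deriv b p v) vs -
        (field_deriv (\<lambda>q. interior v (a q)) p \<and>\<^sub>w b p) vs -
        (grade_inv (interior v (a p)) \<and>\<^sub>w field_deriv b p) vs -
        (field_deriv (\<lambda>q. grade_inv (a q)) p \<and>\<^sub>w interior v (b p)) vs -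
        (a p \<and>\<^sub>w field_deriv (\<lambda>q. interior v (b q)) p) vs"
      by (simp add: interior_field_deriv dir_deriv_wedge interior_wedge field_deriv_add Cons.IH)
    also have "\<dots> = interior v (field_deriv a p \<and>\<^sub>w b p + grade_inv (a p) \<and>\<^sub>w field_deriv b p) vs"
      unfolding interior_add interior_wedge grade_inv_grade_inv interior_field_deriv
        wedge_diff_left wedge_diff_right field_deriv_grade_inv[OF a] grade_inv_interior
        wedge_minus_left plus_fun_apply minus_apply uminus_apply
      by simp
    finally show ?case by (simp add: interior_def)
  qed
qed

lemma field_deriv_exp:
  assumes b: "coeffs_differentiable b p" and two: "\<And>q. two_form (b q)"
  shows "field_deriv (\<lambda>q. ext_exp (b q)) p = field_deriv b p \<and>\<^sub>w ext_exp (b p)"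
proof
  fix vs :: "'a list"
  let ?N = "Suc (Suc (length vs))"
  note nil = two_form_Nil[OF two] and ev = two_form_even[OF two]
  have pw: "(\<lambda>q. ext_power (b q) m ws) differentiable (at p)" for m ws
    using coeffs_differentiable_exp(1)[OF b nil] by (simp add: coeffs_differentiable_def)
  \<comment> \<open>One truncation of the exponential serves for all the shorter lists \<open>ws\<close> in the derivative.\<close>
  have "frechet_derivative (\<lambda>q. ext_exp (b q) ws) (at p) v =
      (\<Sum>m<?N. frechet_derivative (\<lambda>q. ext_power (b q) m ws) (at p) v / fact m)"
    if "length ws \<le> length vs" for ws v
  proof -
    have "((\<lambda>q. \<Sum>m<?N. ext_power (b q) m ws / fact m) has_derivative
        (\<lambda>v. \<Sum>m<?N. frechet_derivative (\<lambda>q. ext_power (b q) m ws) (at p) v / fact m)) (at p)"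
      unfolding divide_inverse
      by (intro has_derivative_sum has_derivative_mult_left)
         (use pw in \<open>simp add: frechet_derivative_works[symmetric]\<close>)
    moreover have "ext_exp (b q) ws = (\<Sum>m<?N. ext_power (b q) m ws / fact m)" for q
      using that by (intro ext_exp_eq_sum nil) simp
    ultimately show ?thesis
      by (simp only: frechet_derivative_at[symmetric])
  qed
  then have "field_deriv (\<lambda>q. ext_exp (b q)) p vs =
      (\<Sum>i<length vs. \<Sum>m<?N. (-1) ^ i * (frechet_derivative
        (\<lambda>q. ext_power (b q) m (take i vs @ drop (Suc i) vs)) (at p) (vs ! i) / fact m))"
    unfolding field_deriv_def by (simp add: sum_distrib_left del: sum.lessThan_Suc)
  also have "\<dots> = (\<Sum>m<?N. field_deriv (\<lambda>q. ext_power (b q) m) p vs / fact m)"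
    unfolding field_deriv_def by (subst sum.swap) (simp add: sum_divide_distrib del: sum.lessThan_Suc)
  also have "\<dots> = (field_deriv b p \<and>\<^sub>w ext_exp (b p)) vs"
  proof (rule derivation_of_exp[OF ev nil])
    show "field_deriv (\<lambda>q. ext_power (b q) 0) p = 0"
      by (rule ext) (simp add: field_deriv_def)
    show "field_deriv (\<lambda>q. ext_power (b q) (Suc m)) p =
        field_deriv b p \<and>\<^sub>w ext_power (b p) m + b p \<and>\<^sub>w field_deriv (\<lambda>q. ext_power (b q) m) p" for m
      using field_deriv_wedge[OF b coeffs_differentiable_exp(1)[OF b nil], of m] by (simp add: ev)
  qed simp
  finally show "field_deriv (\<lambda>q. ext_exp (b q)) p vs = (field_deriv b p \<and>\<^sub>w ext_exp (b p)) vs" .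
qed

lemma forms_coeffs_differentiable:
  assumes "\<omega> \<in> forms A" and "c \<in> A" and "p \<in> chart_image c"
  shows "coeffs_differentiable (\<omega> c) p"
proof -
  have "Ck_on (Suc 0) (chart_image c) (\<lambda>p. \<omega> c p vs)" for vs
    using forms_smooth[OF assms(1,2)] unfolding smooth_on_def by blast
  then show ?thesis using assms(3) by (simp add: coeffs_differentiable_def)
qed

text \<open>
  \<open>d(e\<^sup>B \<and> \<omega>) = dB \<and> e\<^sup>B \<and> \<omega> + e\<^sup>B \<and> d\<omega>\<close>, and the first term cancels against \<open>- dB\<close>. The form \<open>H\<close> commutes
  with the even form \<open>e\<^sup>B\<close>.
\<close>

lemma twisted_deriv_eps:
  assumes B: "B \<in> real_forms 2 A" and H: "H \<in> real_forms 3 A" and \<omega>: "\<omega> \<in> forms A"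
  shows "twisted_deriv A (H - ext_deriv A B) (eps B \<omega>) = eps B (twisted_deriv A H \<omega>)"
proof (intro ext)
  fix c p vs
  have Bf: "B \<in> forms A" and Hf: "H \<in> forms A" using B H by (auto intro: real_forms_forms)
  note two = real_forms_two_form[OF B, of c]
  show "twisted_deriv A (H - ext_deriv A B) (eps B \<omega>) c p vs = eps B (twisted_deriv A H \<omega>) c p vs"
  proof (cases "c \<in> A \<and> p \<in> chart_image c")
    case True
    have d: "ext_deriv A \<eta> c p = field_deriv (\<eta> c) p" for \<eta> :: "('a, 'b) form"
      using True by (simp add: ext_deriv_def field_deriv_def fun_eq_iff)
    note dB = forms_coeffs_differentiable[OF Bf, of c p] and d\<omega> = forms_coeffs_differentiable[OF \<omega>, of c p]
    note E = even_ext_exp[OF two_form_Nil[OF two[of p]] two_form_even[OF two[of p]]]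
    have "field_deriv (eps B \<omega> c) p =
        field_deriv (B c) p \<and>\<^sub>w ext_exp (B c p) \<and>\<^sub>w \<omega> c p + ext_exp (B c p) \<and>\<^sub>w field_deriv (\<omega> c) p"
      unfolding eps_def using True dB d\<omega>
      by (simp add: field_deriv_wedge coeffs_differentiable_exp two_form_Nil[OF two]
          field_deriv_exp two E wedge_assoc)
    then show ?thesis
      by (simp add: twisted_deriv_def form_wedge_def eps_def[of B] d wedge_diff_left wedge_add_right
          even_ext_left_commute[OF E, of "H c p"])
  next
    case False
    then have "\<omega> c p = 0" by (rule forms_zero[OF \<omega>])
    moreover have "ext_deriv A \<eta> c p = 0" for \<eta> :: "('a, 'b) form"
      by (rule ext) (simp only: ext_deriv_def False if_False zero_fun_apply)
    ultimately show ?thesis by (simp add: twisted_deriv_def form_wedge_def eps_def)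
  qed
qed

section \<open>The action of B-fields on smooth forms\<close>

text \<open>
  The derivatives at a point of \<open>S\<close> depend only on the values on \<open>S\<close> because \<open>S\<close> is open. This allows
  derivatives of sums and products to be replaced by the expressions that the calculus rules give.
\<close>

lemma Ck_on_cong:
  assumes "open S" and "\<And>x. x \<in> S \<Longrightarrow> f x = g x" and "Ck_on k S f"
  shows "Ck_on k S g"
  using assms(2, 3)
proof (induction k arbitrary: f g)
  case 0
  then show ?case using continuous_on_cong[of S S f g] by simp
next
  case (Suc k)
  have fg: "(g has_derivative frechet_derivative f (at x)) (at x)" if "x \<in> S" for x
    by (rule has_derivative_transform_within_open[where f = f and s = S])
       (use Suc.prems that \<open>open S\<close> in \<open>auto simp: frechet_derivative_works[symmetric]\<close>)
  have eq: "frechet_derivative f (at x) = frechet_derivative g (at x)" if "x \<in> S" for x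
    by (rule frechet_derivative_at[OF fg[OF that]])
  show ?case
  proof (simp, intro conjI ballI allI)
    show "g differentiable (at x)" if "x \<in> S" for x
      using fg[OF that] by (auto simp: differentiable_def)
    show "Ck_on k S (\<lambda>x. frechet_derivative g (at x) v)" for v
      by (rule Suc.IH[where f = "\<lambda>x. frechet_derivative f (at x) v"])
         (use Suc.prems eq in auto)
  qed
qed

lemma Ck_on_SucD: "Ck_on (Suc k) S f \<Longrightarrow> Ck_on k S f"
proof (induction k arbitrary: f)
  case 0
  then show ?case
    by (auto intro!: continuous_at_imp_continuous_on differentiable_imp_continuous_within)
next
  case (Suc k)
  then show ?case
    unfolding Ck_on.simps(2)[of "Suc k" S f] Ck_on.simps(2)[of k S f] by blast
qed

lemma Ck_on_const: "Ck_on k S (\<lambda>x. z)"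
  by (induction k arbitrary: z) (simp_all add: frechet_derivative_const)

lemma Ck_on_add:
  assumes "open S" and "Ck_on k S f" and "Ck_on k S g"
  shows "Ck_on k S (\<lambda>x. f x + g x)"
  using assms(2, 3)
proof (induction k arbitrary: f g)
  case 0
  then show ?case by (simp add: continuous_on_add)
next
  case (Suc k)
  have "Ck_on k S (\<lambda>x. frechet_derivative (\<lambda>x. f x + g x) (at x) v)" for v
  proof (rule Ck_on_cong[OF \<open>open S\<close>])
    show "Ck_on k S (\<lambda>x. frechet_derivative f (at x) v + frechet_derivative g (at x) v)"
      using Suc by simp
    show "frechet_derivative f (at x) v + frechet_derivative g (at x) v =
        frechet_derivative (\<lambda>x. f x + g x) (at x) v" if "x \<in> S" for x
    proof -
      have "((\<lambda>x. f x + g x) has_derivative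
          (\<lambda>v. frechet_derivative f (at x) v + frechet_derivative g (at x) v)) (at x)"
        using Suc.prems that
        by (intro has_derivative_add) (auto simp: frechet_derivative_works[symmetric])
      from frechet_derivative_at[OF this] show ?thesis by metis
    qed
  qed
  then show ?case using Suc.prems by simp
qed

lemma Ck_on_mult:
  fixes f g :: "'a::real_normed_vector \<Rightarrow> 'b::real_normed_algebra"
  assumes "open S" and "Ck_on k S f" and "Ck_on k S g"
  shows "Ck_on k S (\<lambda>x. f x * g x)"
  using assms(2, 3)
proof (induction k arbitrary: f g)
  case 0
  then show ?case by (simp add: continuous_on_mult)
next
  case (Suc k)
  have "Ck_on k S (\<lambda>x. frechet_derivative (\<lambda>x. f x * g x) (at x) v)" for v
  proof (rule Ck_on_cong[OF \<open>open S\<close>])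
    show "Ck_on k S (\<lambda>x. f x * frechet_derivative g (at x) v + frechet_derivative f (at x) v * g x)"
      using Suc.prems Ck_on_SucD[OF Suc.prems(1)] Ck_on_SucD[OF Suc.prems(2)]
      by (intro Ck_on_add[OF \<open>open S\<close>] Suc.IH) auto
    show "f x * frechet_derivative g (at x) v + frechet_derivative f (at x) v * g x =
        frechet_derivative (\<lambda>x. f x * g x) (at x) v" if "x \<in> S" for x
    proof -
      have "((\<lambda>x. f x * g x) has_derivative
          (\<lambda>v. f x * frechet_derivative g (at x) v + frechet_derivative f (at x) v * g x)) (at x)"
        using Suc.prems that
        by (intro has_derivative_mult) (auto simp: frechet_derivative_works[symmetric])
      from frechet_derivative_at[OF this] show ?thesis by metis
    qed
  qed
  then show ?case using Suc.prems by simp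
qed

lemma smooth_on_const: "smooth_on S (\<lambda>x. z)"
  by (simp add: smooth_on_def Ck_on_const)

lemma smooth_on_mult:
  fixes f g :: "'a::real_normed_vector \<Rightarrow> 'b::real_normed_algebra"
  shows "open S \<Longrightarrow> smooth_on S f \<Longrightarrow> smooth_on S g \<Longrightarrow> smooth_on S (\<lambda>x. f x * g x)"
  by (simp add: smooth_on_def Ck_on_mult)

lemma smooth_on_sum:
  assumes "open S" and "\<And>i. i \<in> I \<Longrightarrow> smooth_on S (f i)"
  shows "smooth_on S (\<lambda>x. \<Sum>i\<in>I. f i x)"
  using assms(2)
  by (induction I rule: infinite_finite_induct)
     (simp_all add: smooth_on_def Ck_on_const Ck_on_add[OF assms(1)])

lemma smooth_on_wedge:
  assumes "open S" and "\<And>vs. smooth_on S (\<lambda>p. a p vs)" and "\<And>vs. smooth_on S (\<lambda>p. b p vs)"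
  shows "smooth_on S (\<lambda>p. (a p \<and>\<^sub>w b p) vs)"
  unfolding wedge_def
  by (intro smooth_on_sum smooth_on_mult smooth_on_const assms)

lemma smooth_on_exp:
  assumes "open S" and b: "\<And>vs. smooth_on S (\<lambda>p. b p vs)" and nil: "\<And>p. b p [] = 0"
  shows "smooth_on S (\<lambda>p. ext_exp (b p) vs)"
proof -
  have "smooth_on S (\<lambda>p. ext_power (b p) m vs)" for m vs
    by (induction m arbitrary: vs) (simp_all add: smooth_on_const smooth_on_wedge assms)
  then show ?thesis
    unfolding ext_exp_eq_sum_Suc[of "b _", OF nil] divide_inverse
    by (intro smooth_on_sum smooth_on_mult smooth_on_const \<open>open S\<close>)
qed

lemma wedge_pullback:
  "(a \<and>\<^sub>w b) (map F vs) = ((\<lambda>vs. a (map F vs)) \<and>\<^sub>w (\<lambda>vs. b (map F vs))) vs"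
  by (simp add: wedge_def nths_map)

lemma ext_exp_pullback: "ext_exp b (map F vs) = ext_exp (\<lambda>vs. b (map F vs)) vs"
proof -
  have "ext_power b m (map F vs) = ext_power (\<lambda>vs. b (map F vs)) m vs" for m vs
  proof (induction m arbitrary: vs)
    case (Suc m)
    then show ?case by (simp add: wedge_pullback)
  qed (simp add: ext_one_def)
  then show ?thesis by (simp add: ext_exp_def)
qed

lemma eps_in_forms:
  assumes "oriented_manifold X A" and B: "B \<in> real_forms 2 A" and \<omega>: "\<omega> \<in> forms A"
  shows "eps B \<omega> \<in> forms A"
proof -
  have Bf: "B \<in> forms A" using B by (rule real_forms_forms)
  have nil: "B c p [] = 0" for c p by (rule two_form_Nil[OF real_forms_two_form[OF B]])
  have op: "open (chart_image c)" if "c \<in> A" for c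
    using assms(1) that by (auto simp: oriented_manifold_def is_chart_def)
  have zero: "eps B \<omega> c p = 0" if "\<not> (c \<in> A \<and> p \<in> chart_image c)" for c p
    using forms_zero[OF \<omega> that] by (simp add: eps_def)
  have alt: "alternating (eps B \<omega> c p)" if "c \<in> A" "p \<in> chart_image c" for c p
    unfolding eps_def
    by (intro alternating_wedge alternating_exp nil forms_alternating[OF Bf that]
        forms_alternating[OF \<omega> that])
  have smooth: "smooth_on (chart_image c) (\<lambda>p. eps B \<omega> c p vs)" if "c \<in> A" for c vs
    unfolding eps_def
    by (intro smooth_on_wedge smooth_on_exp nil op that forms_smooth[OF Bf] forms_smooth[OF \<omega>])
  have glue: "eps B \<omega> c p vs = eps B \<omega> c' (transition c c' p) (map (D_transition c c' p) vs)"
    if "c \<in> A" "c' \<in> A" "p \<in> overlap c c'" for c c' p vs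
    by (simp add: eps_def wedge_pullback ext_exp_pullback forms_pullback[OF Bf that]
        forms_pullback[OF \<omega> that])
  from zero alt smooth glue show ?thesis
    unfolding forms_def mem_Collect_eq by blast
qed

lemma real_forms_uminus:
  assumes "oriented_manifold X A" and B: "B \<in> real_forms k A"
  shows "- B \<in> real_forms k A"
proof -
  have Bf: "B \<in> forms A" using B by (rule real_forms_forms)
  have op: "open (chart_image c)" if "c \<in> A" for c
    using assms(1) that by (auto simp: oriented_manifold_def is_chart_def)
  have alt: "alternating (- a)" if "alternating a" for a :: "(real^'b) ext"
    using that by (simp add: alternating_def linear_compose_neg)
  have smooth: "smooth_on (chart_image c) (\<lambda>p. - B c p vs)" if "c \<in> A" for c vs
    using smooth_on_mult[OF op[OF that] smooth_on_const[of _ "-1"] forms_smooth[OF Bf that]]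
    by simp
  have "- B \<in> forms A"
    using Bf alt smooth unfolding forms_def mem_Collect_eq by simp
  then show ?thesis
    using real_forms_real[OF B] real_forms_degree[OF B] by (simp add: real_forms_def)
qed

lemma eps_uminus_cancel:
  assumes "B \<in> real_forms 2 A"
  shows "eps (- B) (eps B \<omega>) = \<omega>"
proof (intro ext)
  fix c p vs
  note b = real_forms_two_form[OF assms, of c p]
  have "ext_exp (- B c p) \<and>\<^sub>w ext_exp (B c p) = ext_one"
    by (rule ext_exp_inverse[OF two_form_even[OF b] two_form_Nil[OF b]])
  then show "eps (- B) (eps B \<omega>) c p vs = \<omega> c p vs"
    by (simp add: eps_def flip: wedge_assoc)
qed

lemma bij_betw_eps:
  assumes "oriented_manifold X A" and B: "B \<in> real_forms 2 A"
  shows "bij_betw (eps B) (forms A) (forms A)"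
proof (rule bij_betw_byWitness[where f' = "eps (- B)"])
  note B' = real_forms_uminus[OF assms]
  show "\<forall>\<omega>\<in>forms A. eps (- B) (eps B \<omega>) = \<omega>" using eps_uminus_cancel[OF B] by simp
  show "\<forall>\<omega>\<in>forms A. eps B (eps (- B) \<omega>) = \<omega>" using eps_uminus_cancel[OF B'] by simp
  show "eps B ` forms A \<subseteq> forms A" "eps (- B) ` forms A \<subseteq> forms A"
    using eps_in_forms[OF assms(1)] B B' by auto
qed

lemma zero_in_forms: "0 \<in> forms A"
  by (auto simp: forms_def alternating_def linear_zero smooth_on_const)

section \<open>Adjoints and Laplacians under an isometry\<close>

text \<open>
  The defining condition of the adjoint is transported by \<open>E\<close>, so a solution exists uniquely on one
  side if and only if it does on the other; otherwise both adjoints take the default value 0, which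
  \<open>E\<close> preserves. The isometry property is required of all \<open>x\<close> and \<open>y\<close> because it is applied to \<open>P x\<close>,
  and \<open>y\<close> itself will be of this form in the Laplacian, where membership in \<open>V\<close> is not at hand.
\<close>

lemma adjoint_on_isometry:
  fixes E :: "'f::zero \<Rightarrow> 'f"
  assumes E: "bij_betw E V V" and "E 0 = 0"
    and ip: "\<And>x y. ip' (E x) (E y) = ip x y"
    and P: "\<And>x. x \<in> V \<Longrightarrow> P' (E x) = E (P x)"
  shows "adjoint_on V ip' P' (E y) = E (adjoint_on V ip P y)"
proof -
  define Q where "Q z \<longleftrightarrow> z \<in> V \<and> (\<forall>x\<in>V. ip (P x) y = ip x z)" for z
  define Q' where "Q' z \<longleftrightarrow> z \<in> V \<and> (\<forall>x\<in>V. ip' (P' x) (E y) = ip' x z)" for z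
  have V: "V = E ` V" using E by (simp add: bij_betw_def)
  have QQ': "Q' (E z) \<longleftrightarrow> Q z" if "z \<in> V" for z
  proof -
    have "Q' (E z) \<longleftrightarrow> (\<forall>x\<in>E ` V. ip' (P' x) (E y) = ip' x (E z))"
      using that V unfolding Q'_def by blast
    also have "\<dots> \<longleftrightarrow> Q z" using that by (simp add: Q_def P ip)
    finally show ?thesis .
  qed
  have surj: "\<exists>w\<in>V. z = E w" if "z \<in> V" for z using that V by blast
  have inj: "w = z" if "E w = E z" "w \<in> V" "z \<in> V" for w z
    using E that by (auto simp: bij_betw_def inj_on_def)
  have QV: "z \<in> V" if "Q z" for z using that by (simp add: Q_def)
  have QV': "z \<in> V" if "Q' z" for z using that by (simp add: Q'_def)
  have ex: "(\<exists>!z. Q' z) \<longleftrightarrow> (\<exists>!z. Q z)"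
  proof
    assume "\<exists>!z. Q' z"
    then obtain z where z: "Q' z" "\<And>w. Q' w \<Longrightarrow> w = z" by auto
    obtain w where w: "w \<in> V" "z = E w" using surj QV'[OF z(1)] by blast
    show "\<exists>!z. Q z"
    proof (rule ex1I[of _ w])
      show "Q w" using QQ'[OF w(1)] z(1) w(2) by simp
      show "u = w" if "Q u" for u
        using inj[OF _ QV[OF that] w(1)] z(2)[of "E u"] QQ'[OF QV[OF that]] that w(2) by simp
    qed
  next
    assume "\<exists>!z. Q z"
    then obtain z where z: "Q z" "\<And>w. Q w \<Longrightarrow> w = z" by auto
    show "\<exists>!z. Q' z"
    proof (rule ex1I[of _ "E z"])
      show "Q' (E z)" using QQ'[OF QV[OF z(1)]] z(1) by simp
      fix u assume u: "Q' u"
      obtain w where w: "w \<in> V" "u = E w" using surj QV'[OF u] by blast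
      show "u = E z" using z(2)[of w] QQ'[OF w(1)] u w(2) by simp
    qed
  qed
  have the: "(THE z. Q' z) = E (THE z. Q z)" if "\<exists>!z. Q z"
  proof -
    have "Q' (E (THE z. Q z))" using theI'[OF that] QQ' QV by blast
    then show ?thesis using ex that by (intro the1_equality) simp_all
  qed
  have "adjoint_on V ip P y = (if \<exists>!z. Q z then THE z. Q z else 0)"
    unfolding adjoint_on_def Q_def ..
  moreover have "adjoint_on V ip' P' (E y) = (if \<exists>!z. Q' z then THE z. Q' z else 0)"
    unfolding adjoint_on_def Q'_def ..
  ultimately show ?thesis using ex the \<open>E 0 = 0\<close> by simp
qed

lemma adjoint_on_in:
  assumes "0 \<in> V"
  shows "adjoint_on V ip P y \<in> V"
proof (cases "\<exists>!z. z \<in> V \<and> (\<forall>x\<in>V. ip (P x) y = ip x z)")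
  case True
  then have "adjoint_on V ip P y = (THE z. z \<in> V \<and> (\<forall>x\<in>V. ip (P x) y = ip x z))"
    unfolding adjoint_on_def by (rule if_P)
  with theI'[OF True] show ?thesis by (simp only:)
next
  case False
  then have "adjoint_on V ip P y = 0" unfolding adjoint_on_def by (rule if_not_P)
  with assms show ?thesis by simp
qed

theorem proposition3p10:
  fixes X :: "'a topology"
    and A :: "('a, 'n::{finite,linorder}) chart set"
    and g :: "('a, 'n) metric"
    and B H H' :: "('a, 'n) form"
  assumes "oriented_manifold X A"
    and "compact_space X"
    and "riemannian_metric A g"
    and "B \<in> real_forms 2 A"
    and "H \<in> real_forms 3 A"
    and "ext_deriv A H = 0"
    and "H' = H - ext_deriv A B"
  shows "(\<forall>\<omega>\<in>forms A.
            adjoint_on (forms A) (L2_inner X A g) (twisted_deriv A H') \<omega> =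
            (eps B \<circ> adjoint_on (forms A) (BI_inner X A g B) (twisted_deriv A H)
                   \<circ> inv_into (forms A) (eps B)) \<omega>) \<and>
         (\<forall>\<omega>\<in>forms A.
            laplacian_on (forms A) (L2_inner X A g) (twisted_deriv A H') \<omega> =
            (eps B \<circ> laplacian_on (forms A) (BI_inner X A g B) (twisted_deriv A H)
                   \<circ> inv_into (forms A) (eps B)) \<omega>)"
proof -
  let ?d = "twisted_deriv A H" and ?d' = "twisted_deriv A H'"
  let ?a = "adjoint_on (forms A) (BI_inner X A g B) ?d"
  let ?a' = "adjoint_on (forms A) (L2_inner X A g) ?d'"
  have bij: "bij_betw (eps B) (forms A) (forms A)"
    by (rule bij_betw_eps) fact+
  have d: "?d' (eps B \<omega>) = eps B (?d \<omega>)" if "\<omega> \<in> forms A" for \<omega>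
    using twisted_deriv_eps[OF assms(4, 5) that] assms(7) by simp
  have eps_add: "eps B (\<omega> + \<eta>) = eps B \<omega> + eps B \<eta>" for \<omega> \<eta>
    by (intro ext) (simp add: eps_def wedge_add_right)
  have eps_0: "eps B 0 = 0"
    by (intro ext) (simp add: eps_def)
  have a: "?a' (eps B \<omega>) = eps B (?a \<omega>)" for \<omega>
    by (rule adjoint_on_isometry) (fact bij, fact eps_0, fact BI_inner_eq_L2_inner[OF assms(4)], fact d)
  have lap: "laplacian_on (forms A) (L2_inner X A g) ?d' (eps B \<omega>) =
      eps B (laplacian_on (forms A) (BI_inner X A g B) ?d \<omega>)" if "\<omega> \<in> forms A" for \<omega>
    by (simp add: laplacian_on_def d[OF that] a d[OF adjoint_on_in[OF zero_in_forms]] eps_add)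
  have inv: "inv_into (forms A) (eps B) \<omega> \<in> forms A" "eps B (inv_into (forms A) (eps B) \<omega>) = \<omega>"
    if "\<omega> \<in> forms A" for \<omega>
  proof -
    have "\<omega> \<in> eps B ` forms A" using bij that by (simp add: bij_betw_def)
    then show "inv_into (forms A) (eps B) \<omega> \<in> forms A"
      and "eps B (inv_into (forms A) (eps B) \<omega>) = \<omega>"
      by (rule inv_into_into, rule f_inv_into_f)
  qed
  show ?thesis
  proof (intro conjI ballI)
    fix \<omega> assume \<omega>: "\<omega> \<in> forms A"
    show "?a' \<omega> = (eps B \<circ> ?a \<circ> inv_into (forms A) (eps B)) \<omega>"
      using a[of "inv_into (forms A) (eps B) \<omega>"] by (simp add: inv(2)[OF \<omega>])
    show "laplacian_on (forms A) (L2_inner X A g) ?d' \<omega> =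
        (eps B \<circ> laplacian_on (forms A) (BI_inner X A g B) ?d \<circ> inv_into (forms A) (eps B)) \<omega>"
      using lap[OF inv(1)[OF \<omega>]] by (simp add: inv(2)[OF \<omega>])
  qed
qed

end
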